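(* Let $\mathsf{H}$ be a right quaternionic Hilbert space, let $p\in(0,1]$, let $T\in\mathfrak{B}(\mathsf{H})$ be an injective $p$-hyponormal operator, and let $T=U|T|$ be its polar decomposition. For $r\in(0,\tfrac12]$ put $S_r(T)=U|T|^rU$. Then for every $r\in(0,\tfrac12]$: (i) if $0<p\le\tfrac12$, then $S_r(T)$ is $2p$-hyponormal; (ii) if $\tfrac12<p\le1$, then $S_r(T)$ is hyponormal.
   Context: $\mathbb{H}$ is the skew field of quaternions. A right quaternionic Hilbert space $\mathsf{H}$ is a right $\mathbb{H}$-vector space with an inner product $\langle\cdot,\cdot\rangle:\mathsf{H}\times\mathsf{H}\to\mathbb{H}$ satisfying $\overline{\langle u,v\rangle}=\langle v,u\rangle$, $\langle u,u\rangle>0$ for $u\ne0$, $\langle u,vp+wq\rangle=\langle u,v\rangle p+\langle u,w\rangle q$, and complete for $\|u\|=\sqrt{\langle u,u\rangle}$. $\mathfrak{B}(\mathsf{H})$ is the set of bounded right $\mathbb{H}$-linear operators on $\mathsf{H}$; $T^*$ is the adjoint, $\langle Tu,v\rangle=\langle u,T^*v\rangle$. Order: $T$ is positive ($T\ge0$) if $\langle Tx,x\rangle\ge0$ for all $x\in\mathsf{H}$; $S\le T$ means $T-S\ge0$. S-spectrum: for $q\in\mathbb{H}$, $\Delta_q(T)=T^2-T(q+\bar q)+I|q|^2$ (real coefficients); $\sigma_S(T)$ is the set of $q\in\mathbb{H}$ for which $\Delta_q(T)$ has no inverse in $\mathfrak{B}(\mathsf{H})$. For selfadjoint $T$, $\sigma_S(T)$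 is a compact subset of $\mathbb{R}$ (of $[0,\infty)$ if $T\ge 0$). Functional calculus: for selfadjoint $T$ and continuous $f:\sigma_S(T)\to\mathbb{R}$, $f(T)\in\mathfrak{B}(\mathsf{H})$ is the image of $f$ under the unique continuous homomorphism of real unital Banach algebras $\mathcal{C}(\sigma_S(T),\mathbb{R})\to\mathfrak{B}(\mathsf{H})$ sending the identity function to $T$. Positive powers $T^s$, $s>0$, of a positive operator $T$ are defined in this way. Polar decomposition: $|T|=(T^*T)^{1/2}$, and $T=U|T|$ where $U$ is the unique partial isometry with initial space $\ker(|T|)^\perp$ and final space $\overline{\operatorname{Ran}T}$. For $0<s\le1$, $T$ is $s$-hyponormal if $(T^*T)^s\ge(TT^* )^s$; $T$ is hyponormal if $T^*T\ge TT^*$. *)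

theory Defs
  imports "HOL-Analysis.Analysis"
begin

section \<open>Quaternions\<close>

datatype quat = Quat (qRe: real) (qIm1: real) (qIm2: real) (qIm3: real)

lemma quat_eq_iff:
  "p = q \<longleftrightarrow> qRe p = qRe q \<and> qIm1 p = qIm1 q \<and> qIm2 p = qIm2 q \<and> qIm3 p = qIm3 q"
  by (cases p; cases q) simp

instantiation quat :: ring_1
begin

definition zero_quat :: quat where "0 = Quat 0 0 0 0"
definition one_quat :: quat where "1 = Quat 1 0 0 0"
definition plus_quat :: "quat \<Rightarrow> quat \<Rightarrow> quat" where
  "p + q = Quat (qRe p + qRe q) (qIm1 p + qIm1 q) (qIm2 p + qIm2 q) (qIm3 p + qIm3 q)"
definition uminus_quat :: "quat \<Rightarrow> quat" where
  "- p = Quat (- qRe p) (- qIm1 p) (- qIm2 p) (- qIm3 p)"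
definition minus_quat :: "quat \<Rightarrow> quat \<Rightarrow> quat" where
  "p - q = Quat (qRe p - qRe q) (qIm1 p - qIm1 q) (qIm2 p - qIm2 q) (qIm3 p - qIm3 q)"
definition times_quat :: "quat \<Rightarrow> quat \<Rightarrow> quat" where
  "p * q = Quat
     (qRe p * qRe q - qIm1 p * qIm1 q - qIm2 p * qIm2 q - qIm3 p * qIm3 q)
     (qRe p * qIm1 q + qIm1 p * qRe q + qIm2 p * qIm3 q - qIm3 p * qIm2 q)
     (qRe p * qIm2 q - qIm1 p * qIm3 q + qIm2 p * qRe q + qIm3 p * qIm1 q)
     (qRe p * qIm3 q + qIm1 p * qIm2 q - qIm2 p * qIm1 q + qIm3 p * qRe q)"

instance
  by standard
    (simp_all add: quat_eq_iff zero_quat_def one_quat_def plus_quat_def uminus_quat_def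
      minus_quat_def times_quat_def algebra_simps)

end

instantiation quat :: real_algebra_1
begin

definition scaleR_quat :: "real \<Rightarrow> quat \<Rightarrow> quat" where
  "r *\<^sub>R q = Quat (r * qRe q) (r * qIm1 q) (r * qIm2 q) (r * qIm3 q)"

instance
  by standard (simp_all add: quat_eq_iff plus_quat_def times_quat_def scaleR_quat_def algebra_simps)

end

instantiation quat :: real_inner
begin

definition inner_quat :: "quat \<Rightarrow> quat \<Rightarrow> real" where
  "inner p q = qRe p * qRe q + qIm1 p * qIm1 q + qIm2 p * qIm2 q + qIm3 p * qIm3 q"
definition norm_quat :: "quat \<Rightarrow> real" where
  "norm q = sqrt ((qRe q)\<^sup>2 + (qIm1 q)\<^sup>2 + (qIm2 q)\<^sup>2 + (qIm3 q)\<^sup>2)"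
definition sgn_quat :: "quat \<Rightarrow> quat" where
  "sgn q = q /\<^sub>R norm q" for q :: quat
definition dist_quat :: "quat \<Rightarrow> quat \<Rightarrow> real" where
  "dist p q = norm (p - q)" for p q :: quat
definition uniformity_quat :: "(quat \<times> quat) filter" where
  "uniformity = (INF e\<in>{0<..}. principal {(x :: quat, y :: quat). dist x y < e})"
definition open_quat :: "quat set \<Rightarrow> bool" where
  "open U \<longleftrightarrow> (\<forall>x\<in>U. eventually (\<lambda>(x', y). x' = x \<longrightarrow> y \<in> U) uniformity)" for U :: "quat set"

lemma inner_quat_self_0: "inner (q :: quat) q = 0 \<longleftrightarrow> q = 0"
  by (cases q)
    (auto simp: inner_quat_def zero_quat_def add_nonneg_eq_0_iff simp flip: power2_eq_square)

instance
proof
  fix p :: quat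
  show "inner p p = 0 \<longleftrightarrow> p = 0"
    by (rule inner_quat_self_0)
qed (simp_all add: plus_quat_def scaleR_quat_def inner_quat_def norm_quat_def sgn_quat_def
      dist_quat_def uniformity_quat_def open_quat_def algebra_simps power2_eq_square)

end

definition qcnj :: "quat \<Rightarrow> quat" where
  "qcnj q = Quat (qRe q) (- qIm1 q) (- qIm2 q) (- qIm3 q)"

instantiation quat :: real_normed_div_algebra
begin

definition inverse_quat :: "quat \<Rightarrow> quat" where
  "inverse q = qcnj q /\<^sub>R (norm q)\<^sup>2" for q :: quat
definition divide_quat :: "quat \<Rightarrow> quat \<Rightarrow> quat" where
  "divide p q = p * inverse q" for p q :: quat

lemma qcnj_mult_self: "qcnj q * q = (norm q)\<^sup>2 *\<^sub>R 1" "q * qcnj q = (norm q)\<^sup>2 *\<^sub>R 1"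
  by (simp_all add: quat_eq_iff qcnj_def times_quat_def scaleR_quat_def one_quat_def norm_quat_def
      power2_eq_square add_nonneg_nonneg)

instance
proof
  fix p q :: quat
  show "p \<noteq> 0 \<Longrightarrow> inverse p * p = 1" "p \<noteq> 0 \<Longrightarrow> p * inverse p = 1"
    by (simp_all add: inverse_quat_def qcnj_mult_self)
  show "divide p q = p * inverse q"
    by (simp add: divide_quat_def)
  show "inverse (0 :: quat) = 0"
    by (simp add: inverse_quat_def quat_eq_iff scaleR_quat_def zero_quat_def norm_quat_def)
  show "norm (p * q) = norm p * norm q"
    by (simp add: norm_quat_def times_quat_def power2_eq_square algebra_simps
        flip: real_sqrt_mult)
qed

end

section \<open>Right quaternionic Hilbert spaces\<close>

text \<open>
  The real Hilbert space structure is the one every right quaternionic Hilbert space carries: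
  scalars are restricted to the reals and the real inner product is the real part of the
  quaternionic one. In particular the inherited norm is the square root of the (real) quaternion
  \<open>qinner u u\<close>, and positive definiteness is inherited as well.
\<close>

class right_quat_hilbert = real_inner + complete_space +
  fixes scaleQ :: "'a \<Rightarrow> quat \<Rightarrow> 'a"  (infixl \<open>*\<^sub>Q\<close> 75)
    and qinner :: "'a \<Rightarrow> 'a \<Rightarrow> quat"
  assumes scaleQ_add_left: "(u + v) *\<^sub>Q p = u *\<^sub>Q p + v *\<^sub>Q p"
    and scaleQ_add_right: "u *\<^sub>Q (p + q) = u *\<^sub>Q p + u *\<^sub>Q q"
    and scaleQ_scaleQ: "(u *\<^sub>Q p) *\<^sub>Q q = u *\<^sub>Q (p * q)"
    and scaleQ_of_real: "u *\<^sub>Q of_real r = r *\<^sub>R u"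
    and qinner_commute: "qcnj (qinner u v) = qinner v u"
    and qinner_right: "qinner u (v *\<^sub>Q p + w *\<^sub>Q q) = qinner u v * p + qinner u w * q"
    and inner_eq_qRe_qinner: "inner u v = qRe (qinner u v)"
begin

subclass banach ..

end

lemma qinner_self:
  fixes u :: "'h::right_quat_hilbert"
  shows "qinner u u = of_real ((norm u)\<^sup>2)"
  using qinner_commute[of u u] inner_eq_qRe_qinner[of u u]
  by (simp add: power2_norm_eq_inner quat_eq_iff qcnj_def of_real_def scaleR_quat_def one_quat_def)

section \<open>Bounded right linear operators\<close>

definition qbounded_ops :: "('h::right_quat_hilbert \<Rightarrow>\<^sub>L 'h) set"  (\<open>\<BB>\<close>) where
  "\<BB> = {T. \<forall>x q. blinfun_apply T (x *\<^sub>Q q) = blinfun_apply T x *\<^sub>Q q}"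

definition qadjoint :: "('h::right_quat_hilbert \<Rightarrow>\<^sub>L 'h) \<Rightarrow> 'h \<Rightarrow>\<^sub>L 'h" where
  "qadjoint T = (THE S. S \<in> \<BB> \<and>
     (\<forall>u v. qinner (blinfun_apply T u) v = qinner u (blinfun_apply S v)))"

definition qpositive :: "('h::right_quat_hilbert \<Rightarrow>\<^sub>L 'h) \<Rightarrow> bool" where
  "qpositive T \<longleftrightarrow> T \<in> \<BB> \<and> (\<forall>x. qinner (blinfun_apply T x) x \<in> \<real>\<^sub>\<ge>\<^sub>0)"

definition qop_le :: "('h::right_quat_hilbert \<Rightarrow>\<^sub>L 'h) \<Rightarrow> ('h \<Rightarrow>\<^sub>L 'h) \<Rightarrow> bool"
    (infix \<open>\<le>\<^sub>Q\<close> 50) where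
  "S \<le>\<^sub>Q T \<longleftrightarrow> qpositive (T - S)"

section \<open>S-spectrum and continuous functional calculus\<close>

text \<open>\<open>q + qcnj q\<close> is a real quaternion, so it acts on operators as the real scalar
  \<open>qRe (q + qcnj q)\<close>.\<close>

definition S_delta :: "quat \<Rightarrow> ('h::right_quat_hilbert \<Rightarrow>\<^sub>L 'h) \<Rightarrow> 'h \<Rightarrow>\<^sub>L 'h" where
  "S_delta q T = (T o\<^sub>L T) - qRe (q + qcnj q) *\<^sub>R T + (norm q)\<^sup>2 *\<^sub>R id_blinfun"

definition S_spectrum :: "('h::right_quat_hilbert \<Rightarrow>\<^sub>L 'h) \<Rightarrow> quat set" where
  "S_spectrum T =
     {q. \<not> (\<exists>S\<in>\<BB>. S o\<^sub>L S_delta q T = id_blinfun \<and> S_delta q T o\<^sub>L S = id_blinfun)}"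

text \<open>The S-spectrum of a selfadjoint operator consists of real quaternions; this is the
  corresponding set of reals, on which the functional calculus is based.\<close>

definition real_S_spectrum :: "('h::right_quat_hilbert \<Rightarrow>\<^sub>L 'h) \<Rightarrow> real set" where
  "real_S_spectrum T = {x. of_real x \<in> S_spectrum T}"

text \<open>
  \<open>\<phi>\<close> is a continuous homomorphism of real unital algebras from the continuous real functions
  on the spectrum to \<open>\<BB>\<close> that sends the identity function to \<open>T\<close>. A continuous function on the
  spectrum is represented by any real function extending it, hence the second condition. The last
  condition is continuity with respect to the supremum norm on the spectrum.
\<close>

definition continuous_calculus ::
    "('h::right_quat_hilbert \<Rightarrow>\<^sub>L 'h) \<Rightarrow> ((real \<Rightarrow> real) \<Rightarrow> 'h \<Rightarrow>\<^sub>L 'h) \<Rightarrow> bool" where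
  "continuous_calculus T \<phi> \<longleftrightarrow>
     (let \<sigma> = real_S_spectrum T; C = {f. continuous_on \<sigma> f} in
      (\<forall>f\<in>C. \<phi> f \<in> \<BB>) \<and>
      (\<forall>f\<in>C. \<forall>g\<in>C. (\<forall>x\<in>\<sigma>. f x = g x) \<longrightarrow> \<phi> f = \<phi> g) \<and>
      (\<forall>f\<in>C. \<forall>g\<in>C. \<phi> (\<lambda>x. f x + g x) = \<phi> f + \<phi> g) \<and>
      (\<forall>f\<in>C. \<forall>c. \<phi> (\<lambda>x. c * f x) = c *\<^sub>R \<phi> f) \<and>
      (\<forall>f\<in>C. \<forall>g\<in>C. \<phi> (\<lambda>x. f x * g x) = \<phi> f o\<^sub>L \<phi> g) \<and>
      \<phi> (\<lambda>x. 1) = id_blinfun \<and>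
      \<phi> (\<lambda>x. x) = T \<and>
      (\<forall>F f. (\<forall>n::nat. F n \<in> C) \<and> f \<in> C \<and> uniform_limit \<sigma> F f sequentially \<longrightarrow>
         (\<lambda>n. \<phi> (F n)) \<longlonglongrightarrow> \<phi> f))"

text \<open>Only meaningful for selfadjoint \<open>T\<close> and \<open>f\<close> continuous on the spectrum of \<open>T\<close>.\<close>

definition fun_calculus ::
    "(real \<Rightarrow> real) \<Rightarrow> ('h::right_quat_hilbert \<Rightarrow>\<^sub>L 'h) \<Rightarrow> 'h \<Rightarrow>\<^sub>L 'h" where
  "fun_calculus f T = (THE A. \<exists>\<phi>. continuous_calculus T \<phi> \<and> A = \<phi> f)"

definition op_powr :: "('h::right_quat_hilbert \<Rightarrow>\<^sub>L 'h) \<Rightarrow> real \<Rightarrow> 'h \<Rightarrow>\<^sub>L 'h"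
    (infixr \<open>powr\<^sub>Q\<close> 80) where
  "T powr\<^sub>Q s = fun_calculus (\<lambda>x. x powr s) T"

definition op_abs :: "('h::right_quat_hilbert \<Rightarrow>\<^sub>L 'h) \<Rightarrow> 'h \<Rightarrow>\<^sub>L 'h" where
  "op_abs T = (qadjoint T o\<^sub>L T) powr\<^sub>Q (1/2)"

section \<open>Polar decomposition\<close>

definition qorth :: "'h::right_quat_hilbert set \<Rightarrow> 'h set" where
  "qorth M = {x. \<forall>y\<in>M. qinner y x = 0}"

definition op_ker :: "('h::right_quat_hilbert \<Rightarrow>\<^sub>L 'h) \<Rightarrow> 'h set" where
  "op_ker T = {x. blinfun_apply T x = 0}"

definition partial_isometry :: "('h::right_quat_hilbert \<Rightarrow>\<^sub>L 'h) \<Rightarrow> bool" where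
  "partial_isometry U \<longleftrightarrow>
     U \<in> \<BB> \<and> (\<forall>x\<in>qorth (op_ker U). norm (blinfun_apply U x) = norm x)"

definition initial_space :: "('h::right_quat_hilbert \<Rightarrow>\<^sub>L 'h) \<Rightarrow> 'h set" where
  "initial_space U = qorth (op_ker U)"

definition final_space :: "('h::right_quat_hilbert \<Rightarrow>\<^sub>L 'h) \<Rightarrow> 'h set" where
  "final_space U = range (blinfun_apply U)"

definition polar_decomposition :: "('h::right_quat_hilbert \<Rightarrow>\<^sub>L 'h) \<Rightarrow> ('h \<Rightarrow>\<^sub>L 'h) \<Rightarrow> bool" where
  "polar_decomposition T U \<longleftrightarrow>
     T = U o\<^sub>L op_abs T \<and> partial_isometry U \<and>
     initial_space U = qorth (op_ker (op_abs T)) \<and>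
     final_space U = closure (range (blinfun_apply T))"

section \<open>Hyponormality\<close>

definition s_hyponormal :: "real \<Rightarrow> ('h::right_quat_hilbert \<Rightarrow>\<^sub>L 'h) \<Rightarrow> bool" where
  "s_hyponormal s T \<longleftrightarrow>
     T \<in> \<BB> \<and> (T o\<^sub>L qadjoint T) powr\<^sub>Q s \<le>\<^sub>Q (qadjoint T o\<^sub>L T) powr\<^sub>Q s"

definition hyponormal :: "('h::right_quat_hilbert \<Rightarrow>\<^sub>L 'h) \<Rightarrow> bool" where
  "hyponormal T \<longleftrightarrow> T \<in> \<BB> \<and> (T o\<^sub>L qadjoint T) \<le>\<^sub>Q (qadjoint T o\<^sub>L T)"

definition S_transform :: "real \<Rightarrow> ('h::right_quat_hilbert \<Rightarrow>\<^sub>L 'h) \<Rightarrow> ('h \<Rightarrow>\<^sub>L 'h) \<Rightarrow> 'h \<Rightarrow>\<^sub>L 'h" where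
  "S_transform r T U = U o\<^sub>L (op_abs T powr\<^sub>Q r) o\<^sub>L U"

end

theory Submission
  imports Defs "HOL-Computational_Algebra.Fundamental_Theorem_Algebra"
begin

text \<open>
  Let \<open>P = T\<^sup>* T\<close>, so that \<open>|T|\<^sup>r = P\<^bsup>r/2\<^esup>\<close>. Injectivity makes \<open>U\<close> an isometry, and
  \<open>T T\<^sup>* = U P U\<^sup>*\<close>. With \<open>S = S\<^sub>r(T)\<close> and \<open>s = min(2p, 1)\<close>, we have \<open>r s \<le> p\<close> and
  \<open>(S S\<^sup>*)\<^sup>s \<le> (U P\<^sup>r U\<^sup>*)\<^sup>s = U P\<^bsup>rs\<^esup> U\<^sup>* \<le> P\<^bsup>rs\<^esup> \<le> U\<^sup>* P\<^bsup>rs\<^esup> U \<le> (U\<^sup>* P\<^sup>r U)\<^sup>s = (S\<^sup>* S)\<^sup>s\<close>.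
  The first two inequalities are instances of Loewner-Heinz (the second applied to
  \<open>(T T\<^sup>*)\<^sup>p \<le> (T\<^sup>* T)\<^sup>p\<close> with exponent \<open>r s / p\<close>), the third is the second conjugated by \<open>U\<close>,
  and the last is Hansen's inequality. All of this takes place in the underlying real Hilbert
  space, where the S-spectrum of a selfadjoint operator is its approximate point spectrum.
\<close>

section \<open>Operators on real Hilbert spaces\<close>

text \<open>The exponents explain the range of \<open>r\<close>: for \<open>s = 2p\<close> the
  requirement \<open>r s \<le> p\<close> reads \<open>r \<le> 1/2\<close>, and for
  \<open>s = 1\<close>, \<open>p > 1/2\<close> it follows from \<open>r \<le> 1/2\<close>. It keeps
  \<open>r s / p\<close> at most 1, the largest exponent for which Loewner-Heinz holds. The first
  inequality rests on \<open>U U\<^sup>* \<le> 1\<close>, the last on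
  \<open>U\<^sup>* U = 1\<close>, which turns \<open>S\<^sup>* S\<close> into exactly
  \<open>U\<^sup>* P\<^sup>r U\<close>. The real point of view calls for a functional calculus with
  real scalars only. A real polynomial of a selfadjoint operator is factored over the reals: linear
  factors are controlled by the approximate point spectrum, irreducible quadratic ones are coercive.
  This bounds the norm by the supremum over the spectrum, and the calculus is then a limit of
  polynomials. Fractional powers are reached through the functions \<open>x / (x + l)\<close>, for
  which the order inequality is a direct computation with quadratic forms. A two-sided geometric
  series of them takes the place of the usual integral representation of \<open>x powr s\<close>:
  uniform approximation by positive combinations is enough to pass the inequality on.\<close>

definition adjoint_pair :: "('a::real_inner \<Rightarrow>\<^sub>L 'b::real_inner) \<Rightarrow> ('b \<Rightarrow>\<^sub>L 'a) \<Rightarrow> bool" where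
  "adjoint_pair A B \<longleftrightarrow> (\<forall>x y. inner (blinfun_apply A x) y = inner x (blinfun_apply B y))"

definition positive_op :: "('a::real_inner \<Rightarrow>\<^sub>L 'a) \<Rightarrow> bool" where
  "positive_op A \<longleftrightarrow> adjoint_pair A A \<and> (\<forall>x. 0 \<le> inner (blinfun_apply A x) x)"

text \<open>For a selfadjoint operator on a complete space this is equivalent to invertibility,
  since the range is closed with the kernel as its orthogonal complement. It is a pure norm
  estimate, so spectral arguments can be run without constructing inverses.\<close>

definition bounded_below :: "('a::real_normed_vector \<Rightarrow>\<^sub>L 'b::real_normed_vector) \<Rightarrow> bool" where
  "bounded_below A \<longleftrightarrow> (\<exists>c>0. \<forall>x. c * norm x \<le> norm (blinfun_apply A x))"

lemma adjoint_pairD: "adjoint_pair A B \<Longrightarrow> inner (blinfun_apply A x) y = inner x (blinfun_apply B y)"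
  by (simp add: adjoint_pair_def)

lemma adjoint_pair_sym: "adjoint_pair A B \<Longrightarrow> adjoint_pair B A"
  by (simp add: adjoint_pair_def) (metis inner_commute)

lemma adjoint_pair_unique:
  assumes "adjoint_pair A B" "adjoint_pair A C"
  shows "B = C"
proof (rule blinfun_eqI)
  fix y
  have "inner x (B y - C y) = 0" for x
    using adjoint_pairD[OF assms(1), of x y] adjoint_pairD[OF assms(2), of x y]
    by (simp add: inner_diff_right)
  from this[of "B y - C y"] show "B y = C y" by simp
qed

lemma adjoint_pair_compose:
  "adjoint_pair A B \<Longrightarrow> adjoint_pair C D \<Longrightarrow> adjoint_pair (A o\<^sub>L C) (D o\<^sub>L B)"
  by (simp add: adjoint_pair_def)

lemma adjoint_pair_add: "adjoint_pair A B \<Longrightarrow> adjoint_pair C D \<Longrightarrow> adjoint_pair (A + C) (B + D)"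
  by (simp add: adjoint_pair_def blinfun.bilinear_simps inner_simps)

lemma adjoint_pair_scaleR: "adjoint_pair A B \<Longrightarrow> adjoint_pair (c *\<^sub>R A) (c *\<^sub>R B)"
  by (simp add: adjoint_pair_def blinfun.bilinear_simps)

lemma adjoint_pair_id: "adjoint_pair id_blinfun id_blinfun"
  by (simp add: adjoint_pair_def)

lemma adjoint_pair_0: "adjoint_pair 0 0"
  by (simp add: adjoint_pair_def)

lemma closed_adjoint_pair:
  assumes "F \<longlonglongrightarrow> A" "\<And>n. adjoint_pair (F n) (F n)"
  shows "adjoint_pair A A"
  unfolding adjoint_pair_def
proof (intro allI)
  fix x y
  have "(\<lambda>n. inner (F n x) y) \<longlonglongrightarrow> inner (A x) y" "(\<lambda>n. inner x (F n y)) \<longlonglongrightarrow> inner x (A y)"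
    using assms(1) by (auto intro!: tendsto_intros)
  moreover have "(\<lambda>n. inner (F n x) y) = (\<lambda>n. inner x (F n y))"
    using assms(2) by (auto simp: adjoint_pair_def)
  ultimately show "inner (A x) y = inner x (A y)"
    by (metis LIMSEQ_unique)
qed

lemma positive_op_compose_adjoint: "adjoint_pair A B \<Longrightarrow> positive_op (B o\<^sub>L A)"
  unfolding positive_op_def
  by (metis adjoint_pairD adjoint_pair_compose adjoint_pair_sym blinfun_apply_blinfun_compose
      inner_commute inner_ge_zero)

lemma bounded_below_compose:
  assumes "bounded_below A" "bounded_below B"
  shows "bounded_below (A o\<^sub>L B)"
proof -
  obtain c d where *: "c > 0" "d > 0" "\<And>x. c * norm x \<le> norm (A x)" "\<And>x. d * norm x \<le> norm (B x)"
    using assms by (auto simp: bounded_below_def)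
  have "c * d * norm x \<le> norm (A (B x))" for x
    using *(3)[of "B x"] *(4)[of x] \<open>c > 0\<close> 
    by (smt (verit, ccfv_SIG) mult.assoc mult_left_mono)
  with * show ?thesis
    unfolding bounded_below_def by (intro exI[of _ "c * d"]) simp
qed

section \<open>Coercive operators and their inverses\<close>

lemma coercive_bounded_below:
  fixes A :: "'a::real_inner \<Rightarrow>\<^sub>L 'a"
  assumes "c > 0" "\<And>x. c * (norm x)\<^sup>2 \<le> inner (A x) x"
  shows "bounded_below A"
  unfolding bounded_below_def
proof (intro exI conjI allI)
  fix x
  have "c * norm x * norm x \<le> norm (A x) * norm x"
    using assms(2)[of x] norm_cauchy_schwarz[of "A x" x] by (simp add: power2_eq_square)
  then show "c * norm x \<le> norm (A x)"
    by (cases "x = 0") auto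
qed (fact assms)

text \<open>For small \<open>t\<close> the map \<open>u \<mapsto> u - t (A u - z)\<close> is a contraction; its fixed point
  solves \<open>A u = z\<close>.\<close>

lemma coercive_surj:
  fixes A :: "'a::{real_inner,banach} \<Rightarrow>\<^sub>L 'a"
  assumes "c > 0" "\<And>x. c * (norm x)\<^sup>2 \<le> inner (A x) x"
  shows "\<exists>u. A u = z"
proof -
  \<comment> \<open>The summand \<open>c\<close> makes \<open>M\<close> positive and at least
    \<open>c\<close>, so that the radicand in \<open>k\<close> is nonnegative.\<close>
  define M where "M = norm A + c"
  have M: "M > 0" "norm (A x) \<le> M * norm x" for x
    using assms(1) norm_blinfun[of A x] mult_nonneg_nonneg[of c "norm x"]
    by (auto simp: M_def distrib_right simp del: mult_nonneg_nonneg intro: add_nonneg_pos add_increasing2)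
  \<comment> \<open>This \<open>t\<close> minimises \<open>1 - 2 t c + t^2 M^2\<close>, the bound on
    the squared contraction factor; the minimum is \<open>k^2\<close>.\<close>
  define t where "t = c / M\<^sup>2"
  define k where "k = sqrt (1 - c\<^sup>2 / M\<^sup>2)"
  have "c\<^sup>2 \<le> M\<^sup>2" using assms(1) by (intro power_mono) (auto simp: M_def)
  then have k: "0 \<le> k" "k < 1" "k\<^sup>2 = 1 - c\<^sup>2 / M\<^sup>2"
    using M assms(1) by (auto simp: k_def field_simps)
  have contr: "norm (x - t *\<^sub>R A x) \<le> k * norm x" for x
  proof (rule power2_le_imp_le)
    have "(norm (x - t *\<^sub>R A x))\<^sup>2 = (norm x)\<^sup>2 - 2 * t * inner (A x) x + t\<^sup>2 * (norm (A x))\<^sup>2"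
      by (simp add: power2_norm_eq_inner inner_diff_left inner_diff_right inner_commute
          power2_eq_square[of t] algebra_simps)
    also have "\<dots> \<le> (norm x)\<^sup>2 - 2 * t * (c * (norm x)\<^sup>2) + t\<^sup>2 * (M * norm x)\<^sup>2"
      using assms M by (intro add_mono diff_mono mult_left_mono power_mono) (auto simp: t_def)
    also have "\<dots> = (k * norm x)\<^sup>2"
      using M by (simp add: power_mult_distrib k(3)) (simp add: t_def field_simps power2_eq_square)
    finally show "(norm (x - t *\<^sub>R A x))\<^sup>2 \<le> (k * norm x)\<^sup>2" .
  qed (use k in auto)
  have "\<exists>!u. u - t *\<^sub>R (A u - z) = u"
  proof (rule banach_fix_type[OF k(1,2)], intro allI)
    fix x y
    show "dist (x - t *\<^sub>R (A x - z)) (y - t *\<^sub>R (A y - z)) \<le> k * dist x y"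
      using contr[of "x - y"]
      by (simp add: dist_norm blinfun.diff_right scaleR_diff_right algebra_simps)
  qed
  then obtain u where "t *\<^sub>R (A u - z) = 0" by (auto simp: algebra_simps)
  moreover have "t \<noteq> 0" using M assms(1) by (auto simp: t_def)
  ultimately show ?thesis by auto
qed

text \<open>Surjectivity provides a right inverse \<open>g\<close>; the lower bound on
  \<open>A\<close> makes \<open>A\<close> injective, which forces \<open>g\<close> to be linear, and
  it bounds \<open>g\<close> by \<open>1 / d\<close>.\<close>

lemma coercive_inverse:
  fixes A :: "'a::{real_inner,banach} \<Rightarrow>\<^sub>L 'a"
  assumes "c > 0" "\<And>x. c * (norm x)\<^sup>2 \<le> inner (A x) x"
  obtains S where "S o\<^sub>L A = id_blinfun" "A o\<^sub>L S = id_blinfun"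
proof -
  obtain d where d: "d > 0" "\<And>x. d * norm x \<le> norm (A x)"
    using coercive_bounded_below[OF assms] by (auto simp: bounded_below_def)
  have inj: "x = y" if "A x = A y" for x y
    using d(2)[of "x - y"] d(1) that by (simp add: blinfun.diff_right mult_le_0_iff)
  obtain g where g: "A (g z) = z" for z
    using coercive_surj[of c A, OF assms] by metis
  have "bounded_linear g"
  proof (rule bounded_linear_intro[of _ "1 / d"])
    show "g (x + y) = g x + g y" for x y by (rule inj) (simp add: g blinfun.add_right)
    show "g (r *\<^sub>R x) = r *\<^sub>R g x" for r x by (rule inj) (simp add: g blinfun.scaleR_right)
    show "norm (g x) \<le> norm x * (1 / d)" for x
      using d(2)[of "g x"] d(1) by (simp add: g field_simps)
  qed
  then have [simp]: "blinfun_apply (Blinfun g) = g"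
    by (rule bounded_linear_Blinfun_apply)
  show ?thesis
    by (rule that[of "Blinfun g"]) (auto intro!: blinfun_eqI simp: g inj)
qed

text \<open>The representing vector minimises \<open>x \<mapsto> |x|\<^sup>2 - 2 f x\<close>; a minimising sequence is
  Cauchy by the parallelogram law.\<close>

lemma riesz_representation:
  fixes f :: "'a::{real_inner,banach} \<Rightarrow> real"
  assumes "bounded_linear f"
  obtains u where "\<And>x. f x = inner u x"
proof -
  interpret f: bounded_linear f by fact
  obtain K where K: "\<And>x. \<bar>f x\<bar> \<le> norm x * K" using f.bounded by auto
  define J where "J x = (norm x)\<^sup>2 - 2 * f x" for x
  have J_ge: "- K\<^sup>2 \<le> J x" for x
    using K[of x] zero_le_power2[of "norm x - K"]
    by (simp add: J_def power2_eq_square algebra_simps abs_le_iff)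
  then have bdd: "bdd_below (range J)" by (meson bdd_belowI2)
  define m where "m = Inf (range J)"
  have m_le: "m \<le> J x" for x unfolding m_def using bdd by (rule cINF_lower) simp
  have mid: "J ((1/2) *\<^sub>R (x + y)) = (J x + J y) / 2 - (norm (x - y))\<^sup>2 / 4" for x y
    by (simp add: J_def power2_norm_eq_inner inner_simps f.add f.scale inner_commute field_simps)
  have dist_le: "(norm (x - y))\<^sup>2 \<le> 2 * (J x - m) + 2 * (J y - m)" for x y
    using m_le[of "(1/2) *\<^sub>R (x + y)"] unfolding mid by (simp add: field_simps)
  have "\<exists>x. J x < m + 1 / real (Suc n)" for n
    using cINF_less_iff[OF _ bdd, of "m + 1 / real (Suc n)"] by (simp add: m_def)
  then obtain X where X: "\<And>n. J (X n) < m + 1 / real (Suc n)" by metis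
  have "Cauchy X"
  proof (rule metric_CauchyI)
    fix e :: real assume "e > 0"
    then obtain N where N: "1 / real (Suc N) < e\<^sup>2 / 4"
      using reals_Archimedean[of "e\<^sup>2 / 4"] by (auto simp: inverse_eq_divide)
    have small: "J (X n) - m < e\<^sup>2 / 4" if "n \<ge> N" for n
    proof -
      have "1 / real (Suc n) \<le> 1 / real (Suc N)"
        using that by (simp add: field_simps)
      with X[of n] N show ?thesis by linarith
    qed
    have "dist (X a) (X b) < e" if "a \<ge> N" "b \<ge> N" for a b
    proof -
      have "(norm (X a - X b))\<^sup>2 < e\<^sup>2"
        using dist_le[of "X a" "X b"] small[OF that(1)] small[OF that(2)] by simp
      then show ?thesis using \<open>e > 0\<close> by (simp add: dist_norm power2_less_imp_less)
    qed
    then show "\<exists>N. \<forall>a\<ge>N. \<forall>b\<ge>N. dist (X a) (X b) < e" by blast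
  qed
  then obtain u where u: "X \<longlonglongrightarrow> u" using Cauchy_convergent_iff convergent_def by blast
  have "J u \<le> m"
  proof (rule LIMSEQ_le)
    show "(\<lambda>n. J (X n)) \<longlonglongrightarrow> J u"
      unfolding J_def by (intro tendsto_intros f.tendsto u)
    show "(\<lambda>n. m + 1 / real (Suc n)) \<longlonglongrightarrow> m"
      using tendsto_add[OF tendsto_const LIMSEQ_inverse_real_of_nat, of m]
      by (simp add: inverse_eq_divide)
    show "\<exists>N. \<forall>n\<ge>N. J (X n) \<le> m + 1 / real (Suc n)"
      using X less_imp_le by blast
  qed
  have "f x = inner u x" for x
  proof (rule ccontr)
    assume neq: "f x \<noteq> inner u x"
    define d where "d = f x - inner u x"
    have "x \<noteq> 0" using neq f.zero by auto
    \<comment> \<open>Along the line through \<open>u\<close> in direction \<open>x\<close>,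
      \<open>J\<close> is a quadratic in \<open>t\<close> with slope \<open>- 2 * d\<close> at
      \<open>0\<close>. Its vertex lies strictly below \<open>J u\<close> unless
      \<open>d = 0\<close>.\<close>
    define t where "t = d / (norm x)\<^sup>2"
    have "J (u + t *\<^sub>R x) = J u - 2 * t * d + t\<^sup>2 * (norm x)\<^sup>2"
      by (simp add: J_def d_def power2_norm_eq_inner inner_simps f.add f.scale inner_commute
          power2_eq_square[of t] algebra_simps)
    also have "\<dots> = J u - d\<^sup>2 / (norm x)\<^sup>2"
      using \<open>x \<noteq> 0\<close> by (simp add: t_def field_simps power2_eq_square)
    also have "\<dots> < J u"
      using neq \<open>x \<noteq> 0\<close> by (simp add: d_def)
    finally show False using m_le[of "u + t *\<^sub>R x"] \<open>J u \<le> m\<close> by simp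
  qed
  with that show ?thesis by blast
qed

text \<open>Riesz represents \<open>x \<mapsto> inner (A x) y\<close> for each \<open>y\<close>.
  Uniqueness of the representing vector makes it linear in \<open>y\<close>, and testing at
  \<open>x = g y\<close> bounds it by \<open>norm A\<close>.\<close>

lemma adjoint_exists:
  fixes A :: "'a::{real_inner,banach} \<Rightarrow>\<^sub>L 'b::real_inner"
  obtains B where "adjoint_pair A B"
proof -
  have "\<exists>u. \<forall>x. inner (A x) y = inner x u" for y
  proof -
    have "bounded_linear (\<lambda>x. inner (A x) y)"
      by (intro bounded_linear_intros)
    then show ?thesis
      by (metis riesz_representation inner_commute)
  qed
  then obtain g where g: "\<And>x y. inner (A x) y = inner x (g y)" by metis
  have eq: "u = v" if "\<And>x. inner x u = inner x v" for u v :: 'a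
    using that[of "u - v"] inner_eq_zero_iff[of "u - v"] by (simp add: inner_diff_right)
  have "bounded_linear g"
  proof (rule bounded_linear_intro[of _ "norm A"])
    show "g (x + y) = g x + g y" for x y by (rule eq) (simp add: inner_add_right flip: g)
    show "g (r *\<^sub>R x) = r *\<^sub>R g x" for r x by (rule eq) (simp flip: g)
    show "norm (g y) \<le> norm y * norm A" for y
    proof -
      have "norm (g y) * norm (g y) = inner (A (g y)) y"
        by (simp add: g flip: power2_norm_eq_inner power2_eq_square)
      also have "\<dots> \<le> norm A * norm (g y) * norm y"
        using norm_cauchy_schwarz[of "A (g y)" y] norm_blinfun[of A "g y"]
        by (meson mult_right_mono norm_ge_zero order_trans)
      finally show ?thesis
        by (cases "g y = 0") (auto simp: mult_ac)
    qed
  qed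
  then have "adjoint_pair A (Blinfun g)"
    by (simp add: adjoint_pair_def bounded_linear_Blinfun_apply g)
  with that show ?thesis .
qed

section \<open>Polynomials of a selfadjoint operator\<close>

text \<open>Horner's scheme with \<open>T\<close> as the variable, shaped so that induction along
  \<open>pCons\<close> proves the algebraic laws.\<close>

definition poly_op :: "real poly \<Rightarrow> ('a::real_normed_vector \<Rightarrow>\<^sub>L 'a) \<Rightarrow> 'a \<Rightarrow>\<^sub>L 'a" where
  "poly_op p T = fold_coeffs (\<lambda>a B. a *\<^sub>R id_blinfun + (T o\<^sub>L B)) p 0"

lemma poly_op_0 [simp]: "poly_op 0 T = 0"
  by (simp add: poly_op_def)

lemma poly_op_pCons [simp]: "poly_op (pCons a p) T = a *\<^sub>R id_blinfun + (T o\<^sub>L poly_op p T)"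
  by (cases "p = 0"; cases "a = 0")
    (simp_all add: poly_op_def fold_coeffs_pCons_coeff_not_0_eq fold_coeffs_pCons_not_0_0_eq)

lemma poly_op_add: "poly_op (p + q) T = poly_op p T + poly_op q T"
  by (induction p q rule: poly_induct2)
    (auto intro!: blinfun_eqI simp: blinfun.bilinear_simps algebra_simps)

lemma poly_op_smult: "poly_op (smult c p) T = c *\<^sub>R poly_op p T"
  by (induction p) (auto intro!: blinfun_eqI simp: blinfun.bilinear_simps algebra_simps)

lemma poly_op_minus: "poly_op (- p) T = - poly_op p T"
  using poly_op_smult[of "-1" p T] by simp

lemma poly_op_diff: "poly_op (p - q) T = poly_op p T - poly_op q T"
  using poly_op_add[of p "- q" T] by (simp add: poly_op_minus)

lemma poly_op_mult: "poly_op (p * q) T = poly_op p T o\<^sub>L poly_op q T"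
  by (induction p)
    (auto intro!: blinfun_eqI simp: blinfun.bilinear_simps poly_op_add poly_op_smult)

lemma poly_op_commute: "poly_op p T o\<^sub>L poly_op q T = poly_op q T o\<^sub>L poly_op p T"
  by (metis mult.commute poly_op_mult)

lemma poly_op_commute_self: "T o\<^sub>L poly_op p T = poly_op p T o\<^sub>L T"
proof -
  have "poly_op [:0, 1:] T = T" by (auto intro!: blinfun_eqI simp: blinfun.bilinear_simps)
  then show ?thesis by (metis poly_op_commute)
qed

lemma adjoint_pair_poly_op: "adjoint_pair T T \<Longrightarrow> adjoint_pair (poly_op p T) (poly_op p T)"
proof (induction p)
  case (pCons a p)
  then show ?case
    using adjoint_pair_compose[of T T "poly_op p T" "poly_op p T"]
    by (auto intro!: adjoint_pair_add adjoint_pair_scaleR adjoint_pair_id simp: poly_op_commute_self)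
qed (simp add: adjoint_pair_0)

text \<open>Only the lower bound is required to fail. Surjectivity enters later, when
  \<open>real_S_spectrum_eq\<close> identifies this set with the real S-spectrum.\<close>

definition approx_spectrum :: "('a::real_normed_vector \<Rightarrow>\<^sub>L 'a) \<Rightarrow> real set" where
  "approx_spectrum T = {x. \<not> bounded_below (T - x *\<^sub>R id_blinfun)}"

section \<open>Factorisation of real polynomials and lower bounds\<close>

lemma poly_map_of_real:
  "poly (map_poly of_real p) (of_real x :: complex) = of_real (poly p x)"
  by (induction p) (simp_all add: map_poly_pCons)

lemma poly_map_of_real_add:
  "poly (map_poly of_real (p + q)) (z :: complex) =
    poly (map_poly of_real p) z + poly (map_poly of_real q) z"
  by (induction p q rule: poly_induct2) (simp_all add: map_poly_pCons algebra_simps)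

lemma poly_map_of_real_smult:
  "poly (map_poly of_real (smult c p)) (z :: complex) = of_real c * poly (map_poly of_real p) z"
  by (induction p) (simp_all add: map_poly_pCons algebra_simps)

lemma poly_map_of_real_mult:
  "poly (map_poly of_real (p * q)) (z :: complex) =
    poly (map_poly of_real p) z * poly (map_poly of_real q) z"
  by (induction p)
    (simp_all add: map_poly_pCons poly_map_of_real_add poly_map_of_real_smult algebra_simps)

text \<open>One half of a spectral mapping theorem, by splitting off factors. A real root lies
  outside the spectrum, so its linear factor is bounded below; a nonreal root \<open>z\<close>
  contributes \<open>(T - Re z)^2 + (Im z)^2\<close>, which is coercive because \<open>T\<close> is
  selfadjoint. Products of operators bounded below are bounded below.\<close>

lemma bounded_below_poly_op:
  fixes T :: "'a::real_inner \<Rightarrow>\<^sub>L 'a"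
  assumes "adjoint_pair T T" "p \<noteq> 0" "\<And>x. x \<in> approx_spectrum T \<Longrightarrow> poly p x \<noteq> 0"
  shows "bounded_below (poly_op p T)"
  using assms(2,3)
proof (induction "degree p" arbitrary: p rule: less_induct)
  case less
  show ?case
  proof (cases "degree p = 0")
    case True
    then obtain a where "p = [:a:]" by (auto elim: degree_eq_zeroE)
    then show ?thesis using less.prems
      by (auto simp: bounded_below_def blinfun.bilinear_simps intro!: exI[of _ "\<bar>a\<bar>"])
  next
    case False
    let ?c = "map_poly complex_of_real"
    have "degree (?c p) \<noteq> 0" using False by (simp add: degree_map_poly)
    then obtain z where z: "poly (?c p) z = 0"
      using fundamental_theorem_of_algebra[of "?c p"] constant_degree[of "?c p"] by auto
    show ?thesis
    proof (cases "z \<in> \<real>")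
      case True
      then obtain a where a: "z = of_real a" by (auto elim: Reals_cases)
      then have "poly p a = 0" using z by (simp add: a poly_map_of_real)
      then obtain q where q: "p = [:- a, 1:] * q" by (auto simp: poly_eq_0_iff_dvd)
      have "q \<noteq> 0" using q less.prems by auto
      then have "degree q < degree p" unfolding q by (subst degree_mult_eq) auto
      then have "bounded_below (poly_op q T)"
        using less.hyps \<open>q \<noteq> 0\<close> less.prems(2) by (auto simp: q)
      moreover have "bounded_below (T - a *\<^sub>R id_blinfun)"
        using less.prems(2)[of a] \<open>poly p a = 0\<close> by (auto simp: approx_spectrum_def)
      moreover have "poly_op [:- a, 1:] T = T - a *\<^sub>R id_blinfun"
        by (auto intro!: blinfun_eqI simp: blinfun.bilinear_simps)
      ultimately show ?thesis
        unfolding q poly_op_mult by (metis bounded_below_compose)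
    next
      case False
      then have "Im z \<noteq> 0" by (simp add: complex_is_Real_iff)
      \<comment> \<open>The real polynomial with roots \<open>z\<close> and its conjugate.\<close>
      define d where "d = [:(cmod z)\<^sup>2, - 2 * Re z, 1:]"
      have "poly (?c d) z = 0"
        by (simp add: d_def map_poly_pCons complex_eq_iff cmod_power2
            power2_eq_square[of "Re z"] power2_eq_square[of "Im z"] algebra_simps)
      moreover have "poly (?c p) z = poly (?c (p div d)) z * poly (?c d) z + poly (?c (p mod d)) z"
        by (simp flip: poly_map_of_real_add poly_map_of_real_mult)
      ultimately have root: "poly (?c (p mod d)) z = 0" using z by simp
      \<comment> \<open>The remainder is at most linear with real coefficients and vanishes at the
        nonreal \<open>z\<close>: the imaginary part kills \<open>b\<close>, then the real part
        kills \<open>a\<close>. Hence \<open>d\<close> divides \<open>p\<close> over the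
        reals.\<close>
      have "degree (p mod d) < 2"
        using degree_mod_less[of d p] by (auto simp: d_def)
      moreover obtain a r where r: "p mod d = pCons a r"
        by (cases "p mod d")
      ultimately have "degree r = 0" by (auto split: if_splits)
      then obtain b where ab: "p mod d = [:a, b:]"
        using r by (auto elim: degree_eq_zeroE)
      with root have "of_real a + z * of_real b = 0" by (simp add: map_poly_pCons)
      then have "p mod d = 0" using \<open>Im z \<noteq> 0\<close> by (auto simp: ab complex_eq_iff)
      then obtain q where q: "p = d * q" by (auto simp: mod_eq_0_iff_dvd)
      have "q \<noteq> 0" using q less.prems by auto
      then have "degree q < degree p" unfolding q by (subst degree_mult_eq) (auto simp: d_def)
      then have "bounded_below (poly_op q T)"
        using less.hyps \<open>q \<noteq> 0\<close> less.prems(2) by (auto simp: q)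
      moreover have "bounded_below (poly_op d T)"
      proof (rule coercive_bounded_below)
        show "(Im z)\<^sup>2 > 0" using \<open>Im z \<noteq> 0\<close> by simp
        fix x
        have "inner (poly_op d T x) x = (norm (T x - Re z *\<^sub>R x))\<^sup>2 + (Im z)\<^sup>2 * (norm x)\<^sup>2"
          using adjoint_pairD[OF assms(1), of "T x" x]
          unfolding d_def cmod_power2
          by (simp add: blinfun.bilinear_simps power2_norm_eq_inner inner_simps
              inner_commute power2_eq_square[of "Re z"] algebra_simps)
        then show "(Im z)\<^sup>2 * (norm x)\<^sup>2 \<le> inner (poly_op d T x) x" by simp
      qed
      ultimately show ?thesis
        unfolding q poly_op_mult by (metis bounded_below_compose)
    qed
  qed
qed

section \<open>Norm estimates from the spectrum\<close>

lemma blinfun_nonzero_vector: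
  fixes A :: "'a::real_normed_vector \<Rightarrow>\<^sub>L 'b::real_normed_vector"
  assumes "A \<noteq> 0"
  obtains x :: 'a where "x \<noteq> 0"
proof (rule ccontr)
  assume "\<not> thesis"
  with that have zero: "x = 0" for x :: 'a by blast
  have "A = 0" by (rule blinfun_eqI) (subst zero, simp add: blinfun.zero_right)
  with assms show False ..
qed

text \<open>A lower bound for \<open>M^2 - B^2\<close> would improve the norm: expanding
  \<open>|M^2 x - B^2 x|^2\<close> with \<open>inner (B (B x)) x = |B x|^2\<close> shows
  \<open>|B x|^2 \<le> k |x|^2\<close> for some \<open>k < M^2\<close>.\<close>

lemma not_bounded_below_norm_square:
  fixes B :: "'a::real_inner \<Rightarrow>\<^sub>L 'a"
  assumes "adjoint_pair B B" "B \<noteq> 0"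
  shows "\<not> bounded_below ((norm B)\<^sup>2 *\<^sub>R id_blinfun - (B o\<^sub>L B))"
proof
  define M where "M = norm B"
  have "M > 0" using assms by (simp add: M_def)
  assume "bounded_below ((norm B)\<^sup>2 *\<^sub>R id_blinfun - (B o\<^sub>L B))"
  then obtain c where c: "c > 0" "\<And>x. c * norm x \<le> norm (M\<^sup>2 *\<^sub>R x - B (B x))"
    by (auto simp: bounded_below_def M_def blinfun.bilinear_simps)
  \<comment> \<open>Obtained by solving \<open>c^2 |x|^2 \<le> M^2 (M^2 |x|^2 - |B x|^2)\<close> for
    \<open>|B x|^2\<close>.\<close>
  define k where "k = M\<^sup>2 - c\<^sup>2 / M\<^sup>2"
  have *: "(norm (B x))\<^sup>2 \<le> k * (norm x)\<^sup>2" for x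
  proof -
    have "(c * norm x)\<^sup>2 \<le> (norm (M\<^sup>2 *\<^sub>R x - B (B x)))\<^sup>2"
      using c by (intro power_mono) auto
    also have "\<dots> = M\<^sup>2 * (M\<^sup>2 * (norm x)\<^sup>2) - 2 * (M\<^sup>2 * (norm (B x))\<^sup>2) + (norm (B (B x)))\<^sup>2"
      using adjoint_pairD[OF assms(1), of "B x" x]
      by (simp add: power2_norm_eq_inner inner_simps inner_commute algebra_simps)
    also have "(norm (B (B x)))\<^sup>2 \<le> (M * norm (B x))\<^sup>2"
      unfolding M_def by (intro power_mono norm_blinfun) auto
    finally have "c\<^sup>2 * (norm x)\<^sup>2 \<le> M\<^sup>2 * (M\<^sup>2 * (norm x)\<^sup>2 - (norm (B x))\<^sup>2)"
      by (simp add: power_mult_distrib algebra_simps)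
    then show ?thesis
      using \<open>M > 0\<close> by (simp add: k_def field_simps)
  qed
  have "k < M\<^sup>2" using \<open>M > 0\<close> c by (simp add: k_def)
  obtain x :: 'a where "x \<noteq> 0" using blinfun_nonzero_vector[OF assms(2)] .
  have "0 \<le> k * (norm x)\<^sup>2" using *[of x] zero_le_power2 order_trans by blast
  then have "k \<ge> 0" using \<open>x \<noteq> 0\<close> by (simp add: zero_le_mult_iff)
  have "M \<le> sqrt k"
    unfolding M_def
  proof (rule norm_blinfun_bound)
    show "norm (B x) \<le> sqrt k * norm x" for x
      using real_sqrt_le_mono[OF *[of x]] by (simp add: real_sqrt_mult)
  qed (use \<open>k \<ge> 0\<close> in simp)
  from power_mono[OF this, of 2] have "M\<^sup>2 \<le> k" using \<open>M > 0\<close> \<open>k \<ge> 0\<close> by simp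
  with \<open>k < M\<^sup>2\<close> show False by simp
qed

text \<open>For \<open>T \<noteq> 0\<close> the polynomial \<open>(norm T)^2 - X^2\<close> cannot be
  nonzero throughout the spectrum, since its value at \<open>T\<close> is not bounded below. A
  nonzero vector is required because every operator on the trivial space is bounded below.\<close>

lemma approx_spectrum_nonempty:
  fixes T :: "'a::real_inner \<Rightarrow>\<^sub>L 'a"
  assumes "adjoint_pair T T" "x \<noteq> (0::'a)"
  shows "approx_spectrum T \<noteq> {}"
proof (cases "T = 0")
  case True
  then have "0 \<in> approx_spectrum T"
    using assms(2) by (auto simp: approx_spectrum_def bounded_below_def not_le intro!: exI[of _ x])
  then show ?thesis by auto
next
  case False
  have "poly_op [:(norm T)\<^sup>2, 0, -1:] T = (norm T)\<^sup>2 *\<^sub>R id_blinfun - (T o\<^sub>L T)"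
    by (auto intro!: blinfun_eqI simp: blinfun.bilinear_simps)
  then have "\<not> bounded_below (poly_op [:(norm T)\<^sup>2, 0, -1:] T)"
    using not_bounded_below_norm_square[OF assms(1) False] by simp
  then show ?thesis
    using bounded_below_poly_op[OF assms(1), of "[:(norm T)\<^sup>2, 0, -1:]"] by auto
qed

text \<open>With \<open>B = p(T)\<close>, the operator \<open>(norm B)^2 - B^2\<close> is a
  polynomial of \<open>T\<close> that is not bounded below, so \<open>|p|\<close> takes the value
  \<open>norm B\<close> on the spectrum. This estimate carries the whole continuous
  calculus.\<close>

lemma norm_poly_op_le:
  fixes T :: "'a::real_inner \<Rightarrow>\<^sub>L 'a"
  assumes "adjoint_pair T T" "0 \<le> K" "\<And>x. x \<in> approx_spectrum T \<Longrightarrow> \<bar>poly p x\<bar> \<le> K"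
  shows "norm (poly_op p T) \<le> K"
proof (rule ccontr)
  define B where "B = poly_op p T"
  define Q where "Q = [:(norm B)\<^sup>2:] - p * p"
  assume "\<not> norm (poly_op p T) \<le> K"
  then have B: "norm B > K" "B \<noteq> 0" using assms(2) by (auto simp: B_def)
  then obtain x :: 'a where "x \<noteq> 0"
    using blinfun_nonzero_vector by blast
  have "poly_op Q T = (norm B)\<^sup>2 *\<^sub>R id_blinfun - (B o\<^sub>L B)"
    by (simp add: Q_def poly_op_diff poly_op_mult B_def)
  then have "\<not> bounded_below (poly_op Q T)"
    using not_bounded_below_norm_square[of B] adjoint_pair_poly_op[OF assms(1)] B
    by (simp add: B_def)
  \<comment> \<open>If \<open>Q = 0\<close>, any point of the spectrum serves, hence the appeal to
    nonemptiness.\<close>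
  then obtain t where t: "t \<in> approx_spectrum T" "poly Q t = 0"
    using bounded_below_poly_op[OF assms(1), of Q] approx_spectrum_nonempty[OF assms(1) \<open>x \<noteq> 0\<close>]
    by (cases "Q = 0") auto
  then have "(norm B)\<^sup>2 = \<bar>poly p t\<bar>\<^sup>2" by (simp add: Q_def power2_eq_square)
  then have "norm B = \<bar>poly p t\<bar>" by (rule power2_eq_imp_eq) auto
  with assms(3)[OF t(1)] B show False by simp
qed

lemma approx_spectrum_le_norm:
  assumes "x \<in> approx_spectrum T"
  shows "\<bar>x\<bar> \<le> norm T"
proof (rule ccontr)
  assume "\<not> \<bar>x\<bar> \<le> norm T"
  moreover have "(\<bar>x\<bar> - norm T) * norm v \<le> norm (T v - x *\<^sub>R v)" for v
    using norm_triangle_ineq2[of "x *\<^sub>R v" "T v"] norm_blinfun[of T v]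
    by (simp add: algebra_simps norm_minus_commute)
  ultimately have "bounded_below (T - x *\<^sub>R id_blinfun)"
    by (auto simp: bounded_below_def blinfun.bilinear_simps intro!: exI[of _ "\<bar>x\<bar> - norm T"])
  then show False using assms by (simp add: approx_spectrum_def)
qed

text \<open>The complement is open because a lower bound \<open>c\<close> at \<open>x\<close> leaves
  the lower bound \<open>c - |y - x|\<close> at \<open>y\<close>.\<close>

lemma compact_approx_spectrum: "compact (approx_spectrum T)"
proof -
  have "bounded (approx_spectrum T)"
    using approx_spectrum_le_norm[of _ T] by (auto simp: bounded_iff)
  moreover have "open (- approx_spectrum T)"
    unfolding open_dist
  proof
    fix x assume "x \<in> - approx_spectrum T"
    then obtain c where c: "c > 0" "\<And>v. c * norm v \<le> norm (T v - x *\<^sub>R v)"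
      by (auto simp: approx_spectrum_def bounded_below_def blinfun.bilinear_simps)
    have "bounded_below (T - y *\<^sub>R id_blinfun)" if "dist y x < c" for y
    proof -
      have "(c - \<bar>y - x\<bar>) * norm v \<le> norm (T v - y *\<^sub>R v)" for v
      proof -
        have "T v - x *\<^sub>R v = (T v - y *\<^sub>R v) + (y - x) *\<^sub>R v"
          by (simp add: algebra_simps)
        then have "norm (T v - x *\<^sub>R v) \<le> norm (T v - y *\<^sub>R v) + \<bar>y - x\<bar> * norm v"
          by (metis norm_scaleR norm_triangle_ineq)
        with c(2)[of v] show ?thesis by (simp add: left_diff_distrib)
      qed
      then show ?thesis using that
        by (auto simp: bounded_below_def blinfun.bilinear_simps dist_real_def
            intro!: exI[of _ "c - \<bar>y - x\<bar>"])
    qed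
    then show "\<exists>e>0. \<forall>y. dist y x < e \<longrightarrow> y \<in> - approx_spectrum T"
      using c(1) by (auto simp: approx_spectrum_def)
  qed
  ultimately show ?thesis by (simp add: compact_eq_bounded_closed closed_def)
qed

lemma approx_spectrum_positive:
  assumes "positive_op T" "x \<in> approx_spectrum T"
  shows "0 \<le> x"
proof (rule ccontr)
  assume "\<not> 0 \<le> x"
  then have "bounded_below (T - x *\<^sub>R id_blinfun)"
    using assms(1) 
    by (intro coercive_bounded_below[of "- x"])
      (auto simp: positive_op_def blinfun.bilinear_simps inner_simps power2_norm_eq_inner)
  then show False using assms(2) by (simp add: approx_spectrum_def)
qed

section \<open>Continuous functions of a selfadjoint operator\<close>

lemma uniform_limit_poly_exists:
  fixes f :: "real \<Rightarrow> real"
  assumes "compact S" "continuous_on S f"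
  obtains P where "uniform_limit S (\<lambda>n::nat. poly (P n)) f sequentially"
proof -
  have "\<exists>p. \<forall>x\<in>S. \<bar>f x - poly p x\<bar> < 1 / real (Suc n)" for n
  proof -
    obtain g where g: "real_polynomial_function g" "\<And>x. x \<in> S \<Longrightarrow> \<bar>f x - g x\<bar> < 1 / real (Suc n)"
      using Stone_Weierstrass_real_polynomial_function[OF assms, of "1 / real (Suc n)"] by auto
    then obtain a k where "g = (\<lambda>x. \<Sum>i\<le>k. a i * x ^ i)"
      by (auto simp: real_polynomial_function_iff_sum)
    then have "g = poly (\<Sum>i\<le>k. monom (a i) i)" by (auto simp: poly_sum poly_monom)
    with g(2) show ?thesis by auto
  qed
  then obtain P where P: "\<And>n x. x \<in> S \<Longrightarrow> \<bar>f x - poly (P n) x\<bar> < 1 / real (Suc n)" by metis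
  have "uniform_limit S (\<lambda>n. poly (P n)) f sequentially"
  proof (rule uniform_limitI)
    fix e :: real assume "e > 0"
    then obtain N where N: "1 / real (Suc N) < e"
      using reals_Archimedean by (auto simp: inverse_eq_divide)
    show "\<forall>\<^sub>F n in sequentially. \<forall>x\<in>S. dist (poly (P n) x) (f x) < e"
    proof (rule eventually_sequentiallyI[of N], intro ballI)
      fix n x assume "N \<le> n" "x \<in> S"
      have "1 / real (Suc n) \<le> 1 / real (Suc N)" using \<open>N \<le> n\<close> by (simp add: field_simps)
      then show "dist (poly (P n) x) (f x) < e"
        using P[OF \<open>x \<in> S\<close>, of n] N by (simp add: dist_real_def abs_minus_commute)
    qed
  qed
  with that show ?thesis .
qed

text \<open>Quantifying over all approximating sequences builds independence of the choice into the
  definition; such a common limit exists by \<open>op_fun_tendsto\<close>. Only the values of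
  \<open>f\<close> on the spectrum enter.\<close>

definition op_fun :: "(real \<Rightarrow> real) \<Rightarrow> ('a::real_normed_vector \<Rightarrow>\<^sub>L 'a) \<Rightarrow> 'a \<Rightarrow>\<^sub>L 'a" where
  "op_fun f T = (SOME B. \<forall>P. uniform_limit (approx_spectrum T) (\<lambda>n. poly (P n)) f sequentially \<longrightarrow>
     (\<lambda>n. poly_op (P n) T) \<longlonglongrightarrow> B)"

lemma op_fun_tendsto:
  fixes T :: "'a::{real_inner,banach} \<Rightarrow>\<^sub>L 'a"
  assumes sa: "adjoint_pair T T" and f: "continuous_on (approx_spectrum T) f"
    and P: "uniform_limit (approx_spectrum T) (\<lambda>n. poly (P n)) f sequentially"
  shows "(\<lambda>n. poly_op (P n) T) \<longlonglongrightarrow> op_fun f T"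
proof -
  \<comment> \<open>Stated for two sequences so that it gives both the Cauchy property (one sequence
    taken twice) and the independence of the limit from the sequence.\<close>
  have close: "\<exists>N. \<forall>m\<ge>N. \<forall>n\<ge>N. dist (poly_op (Q m) T) (poly_op (R n) T) < e"
    if Q: "uniform_limit (approx_spectrum T) (\<lambda>n. poly (Q n)) f sequentially"
      and R: "uniform_limit (approx_spectrum T) (\<lambda>n. poly (R n)) f sequentially"
      and "e > 0" for Q R :: "nat \<Rightarrow> real poly" and e
  proof -
    have "\<forall>\<^sub>F n in sequentially. \<forall>x\<in>approx_spectrum T.
        dist (poly (Q n) x) (f x) < e/4 \<and> dist (poly (R n) x) (f x) < e/4"
      using eventually_conj[OF uniform_limitD[OF Q, of "e/4"] uniform_limitD[OF R, of "e/4"]] \<open>e > 0\<close>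
      by (simp add: ball_conj_distrib)
    then obtain N where N: "\<And>n x. n \<ge> N \<Longrightarrow> x \<in> approx_spectrum T \<Longrightarrow>
        dist (poly (Q n) x) (f x) < e/4 \<and> dist (poly (R n) x) (f x) < e/4"
      by (auto simp: eventually_sequentially)
    have "norm (poly_op (Q m - R n) T) \<le> e/2" if "m \<ge> N" "n \<ge> N" for m n
    proof (rule norm_poly_op_le[OF sa])
      fix x assume "x \<in> approx_spectrum T"
      with N[of m x] N[of n x] that show "\<bar>poly (Q m - R n) x\<bar> \<le> e/2"
        by (auto simp: dist_real_def abs_if field_simps split: if_splits)
    qed (use \<open>e > 0\<close> in simp)
    then have "dist (poly_op (Q m) T) (poly_op (R n) T) < e" if "m \<ge> N" "n \<ge> N" for m n
      using that \<open>e > 0\<close> by (fastforce simp: dist_norm poly_op_diff)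
    then show ?thesis by blast
  qed
  obtain R where R: "uniform_limit (approx_spectrum T) (\<lambda>n::nat. poly (R n)) f sequentially"
    using uniform_limit_poly_exists[OF compact_approx_spectrum f] .
  have "Cauchy (\<lambda>n. poly_op (R n) T)"
    using close[OF R R] by (intro metric_CauchyI) blast
  then obtain B where B: "(\<lambda>n. poly_op (R n) T) \<longlonglongrightarrow> B"
    using Cauchy_convergent_iff convergent_def by blast
  have "(\<lambda>n. poly_op (Q n) T) \<longlonglongrightarrow> B"
    if "uniform_limit (approx_spectrum T) (\<lambda>n. poly (Q n)) f sequentially" for Q
  proof -
    have "(\<lambda>n. poly_op (Q n) T - poly_op (R n) T) \<longlonglongrightarrow> 0"
      unfolding LIMSEQ_def using close[OF that R] by (simp add: dist_norm) blast
    with B show ?thesis by (rule Lim_transform)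
  qed
  then have "\<forall>Q. uniform_limit (approx_spectrum T) (\<lambda>n. poly (Q n)) f sequentially \<longrightarrow>
      (\<lambda>n. poly_op (Q n) T) \<longlonglongrightarrow> op_fun f T"
    unfolding op_fun_def by (intro someI_ex[of "\<lambda>B. \<forall>Q. _ Q \<longrightarrow> (\<lambda>n. poly_op (Q n) T) \<longlonglongrightarrow> B"]) blast
  with P show ?thesis by blast
qed

lemma op_fun_eqI:
  fixes T :: "'a::{real_inner,banach} \<Rightarrow>\<^sub>L 'a"
  assumes "adjoint_pair T T" "continuous_on (approx_spectrum T) f"
    and "uniform_limit (approx_spectrum T) (\<lambda>n. poly (P n)) f sequentially"
    and "(\<lambda>n. poly_op (P n) T) \<longlonglongrightarrow> B"
  shows "op_fun f T = B"
  using op_fun_tendsto[OF assms(1-3)] assms(4) LIMSEQ_unique by blast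

lemma op_fun_approx:
  fixes T :: "'a::{real_inner,banach} \<Rightarrow>\<^sub>L 'a"
  assumes "adjoint_pair T T" "continuous_on (approx_spectrum T) f"
  obtains P where "uniform_limit (approx_spectrum T) (\<lambda>n. poly (P n)) f sequentially"
    and "(\<lambda>n. poly_op (P n) T) \<longlonglongrightarrow> op_fun f T"
  using uniform_limit_poly_exists[OF compact_approx_spectrum assms(2)] op_fun_tendsto[OF assms]
  by metis

lemma op_fun_cong:
  "(\<And>x. x \<in> approx_spectrum T \<Longrightarrow> f x = g x) \<Longrightarrow> op_fun f T = op_fun g T"
  unfolding op_fun_def by (simp cong: uniform_limit_cong')

lemma op_fun_poly:
  fixes T :: "'a::{real_inner,banach} \<Rightarrow>\<^sub>L 'a"
  assumes "adjoint_pair T T"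
  shows "op_fun (poly p) T = poly_op p T"
  using assms by (rule op_fun_eqI[where P = "\<lambda>_. p"]) (auto intro!: continuous_intros uniform_limit_const)

lemma op_fun_ident:
  fixes T :: "'a::{real_inner,banach} \<Rightarrow>\<^sub>L 'a"
  assumes "adjoint_pair T T"
  shows "op_fun (\<lambda>x. x) T = T"
proof -
  have "poly [:0, 1:] = (\<lambda>x::real. x)" by auto
  moreover have "poly_op [:0, 1:] T = T" by (auto intro!: blinfun_eqI simp: blinfun.bilinear_simps)
  ultimately show ?thesis by (metis op_fun_poly[OF assms])
qed

lemma op_fun_const:
  fixes T :: "'a::{real_inner,banach} \<Rightarrow>\<^sub>L 'a"
  assumes "adjoint_pair T T"
  shows "op_fun (\<lambda>x. c) T = c *\<^sub>R id_blinfun"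
proof -
  have "poly [:c:] = (\<lambda>x::real. c)" by auto
  moreover have "poly_op [:c:] T = c *\<^sub>R id_blinfun"
    by (auto intro!: blinfun_eqI simp: blinfun.bilinear_simps)
  ultimately show ?thesis by (metis op_fun_poly[OF assms])
qed

lemma op_fun_add:
  fixes T :: "'a::{real_inner,banach} \<Rightarrow>\<^sub>L 'a"
  assumes "adjoint_pair T T" "continuous_on (approx_spectrum T) f" "continuous_on (approx_spectrum T) g"
  shows "op_fun (\<lambda>x. f x + g x) T = op_fun f T + op_fun g T"
proof -
  obtain P where P: "uniform_limit (approx_spectrum T) (\<lambda>n. poly (P n)) f sequentially"
    "(\<lambda>n. poly_op (P n) T) \<longlonglongrightarrow> op_fun f T" using op_fun_approx[OF assms(1,2)] .
  obtain Q where Q: "uniform_limit (approx_spectrum T) (\<lambda>n. poly (Q n)) g sequentially"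
    "(\<lambda>n. poly_op (Q n) T) \<longlonglongrightarrow> op_fun g T" using op_fun_approx[OF assms(1,3)] .
  show ?thesis
  proof (rule op_fun_eqI[where P = "\<lambda>n. P n + Q n"])
    show "uniform_limit (approx_spectrum T) (\<lambda>n. poly (P n + Q n)) (\<lambda>x. f x + g x) sequentially"
      using uniform_limit_add[OF P(1) Q(1)] by (simp add: poly_add[abs_def])
    show "(\<lambda>n. poly_op (P n + Q n) T) \<longlonglongrightarrow> op_fun f T + op_fun g T"
      unfolding poly_op_add by (intro tendsto_add P Q)
  qed (use assms in \<open>auto intro!: continuous_intros\<close>)
qed

lemma op_fun_mult:
  fixes T :: "'a::{real_inner,banach} \<Rightarrow>\<^sub>L 'a"
  assumes "adjoint_pair T T" "continuous_on (approx_spectrum T) f" "continuous_on (approx_spectrum T) g"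
  shows "op_fun (\<lambda>x. f x * g x) T = op_fun f T o\<^sub>L op_fun g T"
proof -
  obtain P where P: "uniform_limit (approx_spectrum T) (\<lambda>n. poly (P n)) f sequentially"
    "(\<lambda>n. poly_op (P n) T) \<longlonglongrightarrow> op_fun f T" using op_fun_approx[OF assms(1,2)] .
  obtain Q where Q: "uniform_limit (approx_spectrum T) (\<lambda>n. poly (Q n)) g sequentially"
    "(\<lambda>n. poly_op (Q n) T) \<longlonglongrightarrow> op_fun g T" using op_fun_approx[OF assms(1,3)] .
  \<comment> \<open>Products of uniform limits converge uniformly only for bounded limits;
    compactness of the spectrum supplies the bounds.\<close>
  have "bounded (f ` approx_spectrum T)" "bounded (g ` approx_spectrum T)"
    by (intro compact_imp_bounded compact_continuous_image compact_approx_spectrum assms)+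
  note bdd = this
  show ?thesis
  proof (rule op_fun_eqI[where P = "\<lambda>n. P n * Q n"])
    show "uniform_limit (approx_spectrum T) (\<lambda>n. poly (P n * Q n)) (\<lambda>x. f x * g x) sequentially"
      using uniform_lim_mult[OF P(1) Q(1) bdd] by (simp add: poly_mult[abs_def])
    show "(\<lambda>n. poly_op (P n * Q n) T) \<longlonglongrightarrow> (op_fun f T o\<^sub>L op_fun g T)"
      unfolding poly_op_mult by (intro tendsto_intros P Q)
  qed (use assms in \<open>auto intro!: continuous_intros\<close>)
qed

lemma op_fun_cmult:
  fixes T :: "'a::{real_inner,banach} \<Rightarrow>\<^sub>L 'a"
  assumes "adjoint_pair T T" "continuous_on (approx_spectrum T) f"
  shows "op_fun (\<lambda>x. c * f x) T = c *\<^sub>R op_fun f T"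
  using op_fun_mult[OF assms(1) continuous_on_const assms(2), of c] op_fun_const[OF assms(1), of c]
  by (auto intro!: blinfun_eqI simp: blinfun.bilinear_simps)

lemma op_fun_diff:
  fixes T :: "'a::{real_inner,banach} \<Rightarrow>\<^sub>L 'a"
  assumes "adjoint_pair T T" "continuous_on (approx_spectrum T) f" "continuous_on (approx_spectrum T) g"
  shows "op_fun (\<lambda>x. f x - g x) T = op_fun f T - op_fun g T"
  using op_fun_add[OF assms(1,2), of "\<lambda>x. -1 * g x"] op_fun_cmult[OF assms(1,3), of "-1"] assms(3)
  by (simp add: continuous_on_minus)

lemma op_fun_sum:
  fixes T :: "'a::{real_inner,banach} \<Rightarrow>\<^sub>L 'a"
  assumes "adjoint_pair T T" "\<And>i. i \<in> I \<Longrightarrow> continuous_on (approx_spectrum T) (f i)"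
  shows "op_fun (\<lambda>x. \<Sum>i\<in>I. f i x) T = (\<Sum>i\<in>I. op_fun (f i) T)"
  using assms(2)
proof (induction I rule: infinite_finite_induct)
  case (insert i I)
  then have "continuous_on (approx_spectrum T) (\<lambda>x. \<Sum>i\<in>I. f i x)"
    by (intro continuous_on_sum) auto
  with insert show ?case
    by (simp add: op_fun_add[OF assms(1)])
qed (simp_all add: op_fun_const[OF assms(1)])

lemma norm_op_fun_le:
  fixes T :: "'a::{real_inner,banach} \<Rightarrow>\<^sub>L 'a"
  assumes "adjoint_pair T T" "continuous_on (approx_spectrum T) f"
    and "0 \<le> K" "\<And>x. x \<in> approx_spectrum T \<Longrightarrow> \<bar>f x\<bar> \<le> K"
  shows "norm (op_fun f T) \<le> K"
proof (rule field_le_epsilon)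
  fix e :: real assume "e > 0"
  obtain P where P: "uniform_limit (approx_spectrum T) (\<lambda>n. poly (P n)) f sequentially"
    "(\<lambda>n. poly_op (P n) T) \<longlonglongrightarrow> op_fun f T" using op_fun_approx[OF assms(1,2)] .
  have "\<forall>\<^sub>F n in sequentially. norm (poly_op (P n) T) \<le> K + e"
    using uniform_limitD[OF P(1) \<open>e > 0\<close>]
  proof eventually_elim
    case (elim n)
    show ?case
    proof (rule norm_poly_op_le[OF assms(1)])
      fix x assume "x \<in> approx_spectrum T"
      with elim assms(4)[of x] show "\<bar>poly (P n) x\<bar> \<le> K + e"
        by (fastforce simp: dist_real_def)
    qed (use assms(3) \<open>e > 0\<close> in simp)
  qed
  moreover have "(\<lambda>n. norm (poly_op (P n) T)) \<longlonglongrightarrow> norm (op_fun f T)"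
    by (intro tendsto_norm P)
  ultimately show "norm (op_fun f T) \<le> K + e"
    by (intro tendsto_upperbound[where F = sequentially and f = "\<lambda>n. norm (poly_op (P n) T)"]) auto
qed

lemma op_fun_uniform_limit:
  fixes T :: "'a::{real_inner,banach} \<Rightarrow>\<^sub>L 'a"
  assumes "adjoint_pair T T" "continuous_on (approx_spectrum T) f"
    and "\<And>n. continuous_on (approx_spectrum T) (F n)"
    and "uniform_limit (approx_spectrum T) F f sequentially"
  shows "(\<lambda>n::nat. op_fun (F n) T) \<longlonglongrightarrow> op_fun f T"
proof (rule tendstoI)
  fix e :: real assume "e > 0"
  then have "\<forall>\<^sub>F n in sequentially. \<forall>x\<in>approx_spectrum T. dist (F n x) (f x) < e/2"
    using uniform_limitD[OF assms(4), of "e/2"] by simp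
  then show "\<forall>\<^sub>F n in sequentially. dist (op_fun (F n) T) (op_fun f T) < e"
  proof eventually_elim
    case (elim n)
    have "norm (op_fun (\<lambda>x. F n x - f x) T) \<le> e/2"
      using elim \<open>e > 0\<close>
      by (intro norm_op_fun_le assms continuous_on_diff) (auto simp: dist_real_def less_imp_le)
    then show ?case using \<open>e > 0\<close> by (simp add: op_fun_diff assms dist_norm)
  qed
qed

lemma adjoint_pair_op_fun:
  fixes T :: "'a::{real_inner,banach} \<Rightarrow>\<^sub>L 'a"
  assumes "adjoint_pair T T" "continuous_on (approx_spectrum T) f"
  shows "adjoint_pair (op_fun f T) (op_fun f T)"
  by (metis op_fun_approx[OF assms] closed_adjoint_pair adjoint_pair_poly_op[OF assms(1)])

text \<open>With \<open>B = op_fun (\<lambda>x. sqrt (f x)) T\<close> selfadjoint, the operator in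
  question is \<open>B o\<^sub>L B\<close>.\<close>

lemma positive_op_fun:
  fixes T :: "'a::{real_inner,banach} \<Rightarrow>\<^sub>L 'a"
  assumes "adjoint_pair T T" "continuous_on (approx_spectrum T) f"
    and "\<And>x. x \<in> approx_spectrum T \<Longrightarrow> 0 \<le> f x"
  shows "positive_op (op_fun f T)"
proof -
  have cont: "continuous_on (approx_spectrum T) (\<lambda>x. sqrt (f x))"
    using assms by (intro continuous_intros)
  have "op_fun f T = op_fun (\<lambda>x. sqrt (f x) * sqrt (f x)) T"
    by (rule op_fun_cong) (simp add: assms)
  also have "\<dots> = op_fun (\<lambda>x. sqrt (f x)) T o\<^sub>L op_fun (\<lambda>x. sqrt (f x)) T"
    by (rule op_fun_mult[OF assms(1) cont cont])
  finally show ?thesis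
    using positive_op_compose_adjoint adjoint_pair_op_fun[OF assms(1) cont] by metis
qed

lemma poly_op_op_fun:
  fixes T :: "'a::{real_inner,banach} \<Rightarrow>\<^sub>L 'a"
  assumes "adjoint_pair T T" "continuous_on (approx_spectrum T) f"
  shows "poly_op p (op_fun f T) = op_fun (\<lambda>x. poly p (f x)) T"
proof (induction p)
  case (pCons a p)
  have "continuous_on (approx_spectrum T) (\<lambda>x. f x * poly p (f x))"
    using assms(2) by (intro continuous_intros)
  then show ?case
    using assms pCons by (simp add: op_fun_add op_fun_const op_fun_mult continuous_on_poly)
qed (simp add: op_fun_const[OF assms(1)])

text \<open>A compact \<open>S\<close> containing both the values of \<open>f\<close> and the
  spectrum of \<open>f(T)\<close> takes the place of the spectral mapping theorem: polynomials
  approximating \<open>g\<close> on \<open>S\<close> serve both sides.\<close>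

lemma op_fun_op_fun:
  fixes T :: "'a::{real_inner,banach} \<Rightarrow>\<^sub>L 'a"
  assumes T: "adjoint_pair T T" and f: "continuous_on (approx_spectrum T) f"
    and S: "compact S" "continuous_on S g" "f ` approx_spectrum T \<subseteq> S"
      "approx_spectrum (op_fun f T) \<subseteq> S"
  shows "op_fun g (op_fun f T) = op_fun (\<lambda>x. g (f x)) T"
proof -
  obtain P where P: "uniform_limit S (\<lambda>n. poly (P n)) g sequentially"
    using uniform_limit_poly_exists[OF S(1,2)] .
  show ?thesis
  proof (rule op_fun_eqI[where P = P])
    show "continuous_on (approx_spectrum (op_fun f T)) g"
      using S continuous_on_subset by blast
    show "uniform_limit (approx_spectrum (op_fun f T)) (\<lambda>n. poly (P n)) g sequentially"
      using P S(4) uniform_limit_on_subset by blast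
    have "uniform_limit (approx_spectrum T) (\<lambda>n x. poly (P n) (f x)) (\<lambda>x. g (f x)) sequentially"
      using P S(3) by (auto simp: uniform_limit_iff image_subset_iff elim!: eventually_mono)
    then show "(\<lambda>n. poly_op (P n) (op_fun f T)) \<longlonglongrightarrow> op_fun (\<lambda>x. g (f x)) T"
      unfolding poly_op_op_fun[OF T f]
      by (rule op_fun_uniform_limit[OF T continuous_on_compose2[OF S(2) f S(3)]
            continuous_on_poly[OF f]])
  qed (rule adjoint_pair_op_fun[OF T f])
qed

section \<open>Fractional powers\<close>

text \<open>The series \<open>G x = (\<Sum>k\<in>\<int>. \<beta>\<^sup>k x / (x + b\<^sup>k))\<close> with \<open>\<beta> = b\<^sup>s\<close> is increasing and satisfies
  \<open>G (b x) = \<beta> G x\<close>, which pins down \<open>G x / G 1\<close> up to a factor \<open>\<beta>\<close>, close to 1.\<close>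

lemma powr_resolvent_approx:
  fixes s M e :: real
  assumes s: "0 < s" "s < 1" and M: "0 \<le> M" and e: "0 < e"
  obtains I :: "(nat + nat) set" and c l where "finite I" "\<And>i. 0 \<le> c i" "\<And>i. 0 < l i"
    "\<And>x. 0 \<le> x \<Longrightarrow> x \<le> M \<Longrightarrow> \<bar>(\<Sum>i\<in>I. c i * (x / (x + l i))) - x powr s\<bar> \<le> e"
proof -
  \<comment> \<open>Chosen so that \<open>M powr s * (\<beta> - 1) \<le> e / 2\<close>.\<close>
  define \<beta> where "\<beta> = 1 + e / (2 * (M powr s + 1))"
  define b where "b = \<beta> powr (1 / s)"
  have "M powr s + 1 > 0" by (simp add: add_nonneg_pos)
  then have \<beta>: "\<beta> > 1" using e by (simp add: \<beta>_def)
  have \<beta>_err: "y * (\<beta> - 1) \<le> e / 2" if "y \<le> M powr s" for y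
  proof -
    have "y * e \<le> (M powr s + 1) * e" using that e by (intro mult_right_mono) auto
    then show ?thesis using \<open>M powr s + 1 > 0\<close> by (simp add: \<beta>_def field_simps)
  qed
  have bs: "b powr s = \<beta>" using s \<beta> by (simp add: b_def powr_powr)
  \<comment> \<open>Here \<open>s < 1\<close> enters: \<open>\<beta> < b\<close> makes the terms
    with nonnegative index decay like \<open>(\<beta> / b)^n\<close>.\<close>
  have "\<beta> powr 1 < b" unfolding b_def using s \<beta> by (intro powr_less_mono) auto
  then have b: "b > \<beta>" "b > 1" using \<beta> by auto

  \<comment> \<open>\<open>u\<close> collects the indices \<open>k = n \<ge> 0\<close> and
    \<open>v\<close> the indices \<open>k = -(n + 1)\<close>, hence the
    \<open>Suc n\<close>.\<close>
  define u where "u n x = \<beta> ^ n * (x / (x + b ^ n))" for n x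
  define v where "v n x = (1 / \<beta>) ^ Suc n * (x / (x + (1 / b) ^ Suc n))" for n x
  have pow_pos: "b ^ n > 0" "\<beta> ^ n > 0" for n using b \<beta> by auto
  have u_nonneg: "0 \<le> u n x" and v_nonneg: "0 \<le> v n x" if "0 \<le> x" for n x
    using that b \<beta> by (auto simp: u_def v_def)
  have u_le: "norm (u n x) \<le> (\<beta> / b) ^ n * K" if "0 \<le> x" "x \<le> K" for n x K
  proof -
    have "x / (x + b ^ n) \<le> K / b ^ n" using that pow_pos(1)[of n] by (intro frac_le) auto
    then have "u n x \<le> \<beta> ^ n * (K / b ^ n)"
      unfolding u_def using \<beta> by (intro mult_left_mono) auto
    then show ?thesis using u_nonneg[OF that(1)] by (simp add: power_divide)
  qed
  have v_le: "norm (v n x) \<le> (1 / \<beta>) ^ Suc n" if "0 \<le> x" for n x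
  proof -
    have "x + (1 / b) ^ Suc n > 0" using that b by (intro add_nonneg_pos) auto
    then have "x / (x + (1 / b) ^ Suc n) \<le> 1" using b by (simp add: field_simps)
    then have "v n x \<le> (1 / \<beta>) ^ Suc n * 1"
      unfolding v_def using \<beta> by (intro mult_left_mono) auto
    then show ?thesis using v_nonneg[OF that] by simp
  qed
  have sum_u: "summable (\<lambda>n. (\<beta> / b) ^ n * K)" for K
    using b \<beta> by (intro summable_mult2 summable_geometric) auto
  have sum_v: "summable (\<lambda>n. (1 / \<beta>) ^ Suc n)"
    using \<beta> by (simp only: power_Suc) (intro summable_mult summable_geometric, auto)
  have u_summable: "summable (\<lambda>n. u n x)" if "0 \<le> x" for x
    by (rule summable_comparison_test'[OF sum_u u_le]) (use that in auto)
  have v_summable: "summable (\<lambda>n. v n x)" if "0 \<le> x" for x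
    by (rule summable_comparison_test'[OF sum_v v_le]) (use that in auto)

  define G where "G x = (\<Sum>n. u n x) + (\<Sum>n. v n x)" for x
  \<comment> \<open>Scaling by \<open>b\<close> shifts the index by one; the single term that
    crosses between the two halves is \<open>u 0 (b * x) = \<beta> * v 0 x\<close>.\<close>
  have G_scale: "G (b * x) = \<beta> * G x" if "0 \<le> x" for x
  proof -
    have bx: "0 \<le> b * x" using that b by simp
    have "u (Suc n) (b * x) = \<beta> * u n x" for n
    proof -
      have "b * x / (b * x + b ^ Suc n) = x / (x + b ^ n)"
        using b by (subst mult_divide_mult_cancel_left[of b x, symmetric]) (auto simp: distrib_left)
      then show ?thesis by (simp add: u_def)
    qed
    then have "(\<Sum>n. u n (b * x)) = \<beta> * (\<Sum>n. u n x) + u 0 (b * x)"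
      using suminf_split_head[OF u_summable[OF bx]] suminf_mult[OF u_summable[OF that], of \<beta>] by simp
    moreover have "v n (b * x) = \<beta> * v (Suc n) x" for n
    proof -
      have "b * x / (b * x + (1 / b) ^ Suc n) = x / (x + (1 / b) ^ Suc (Suc n))"
        using b by (subst mult_divide_mult_cancel_left[of b x, symmetric]) (auto simp: distrib_left)
      then show ?thesis using \<beta> by (simp add: v_def)
    qed
    then have "(\<Sum>n. v n (b * x)) = \<beta> * ((\<Sum>n. v n x) - v 0 x)"
      using suminf_split_head[OF v_summable[OF that]] v_summable[OF that]
        suminf_mult[of "\<lambda>n. v (Suc n) x" \<beta>] summable_Suc_iff[of "\<lambda>n. v n x"] by simp
    moreover have "u 0 (b * x) = \<beta> * v 0 x"
    proof -
      have "b * x / (b * x + 1) = x / (x + 1 / b)"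
        using b by (subst mult_divide_mult_cancel_left[of b x, symmetric]) (auto simp: distrib_left)
      then show ?thesis using \<beta> by (simp add: u_def v_def)
    qed
    ultimately show ?thesis by (simp add: G_def algebra_simps)
  qed
  have frac_mono: "x / (x + d) \<le> y / (y + d)" if "0 \<le> x" "x \<le> y" "0 < d" for x y d :: real
    using that by (simp add: field_simps)
  have G_mono: "G x \<le> G y" if "0 \<le> x" "x \<le> y" for x y
    unfolding G_def u_def v_def
  proof (intro add_mono suminf_le mult_left_mono frac_mono)
    show "summable (\<lambda>n. \<beta> ^ n * (x / (x + b ^ n)))" "summable (\<lambda>n. \<beta> ^ n * (y / (y + b ^ n)))"
      using u_summable[of x] u_summable[of y] that by (auto simp: u_def)
    show "summable (\<lambda>n. (1 / \<beta>) ^ Suc n * (x / (x + (1 / b) ^ Suc n)))"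
      "summable (\<lambda>n. (1 / \<beta>) ^ Suc n * (y / (y + (1 / b) ^ Suc n)))"
      using v_summable[of x] v_summable[of y] that by (auto simp: v_def)
  qed (use that b \<beta> in auto)
  have "0 < u 0 1" by (simp add: u_def)
  also have "u 0 1 \<le> (\<Sum>n. u n 1)"
    using sum_le_suminf[OF u_summable[of 1], of "{0}"] u_nonneg[of 1] by simp
  also have "\<dots> \<le> G 1"
    using suminf_nonneg[OF v_summable[of 1]] v_nonneg[of 1] by (simp add: G_def)
  finally have G1: "G 1 > 0" .
  have G_powr: "G (b powr of_int m) = (b powr of_int m) powr s * G 1" for m :: int
  proof (induction m rule: int_induct[where k = 0])
    case (step1 m)
    then show ?case
      using b G_scale[of "b powr of_int m"] by (simp add: powr_add powr_mult bs mult_ac)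
  next
    case (step2 m)
    have eq: "b powr of_int m = b * b powr of_int (m - 1)"
      using b by (simp add: powr_diff)
    have "\<beta> * G (b powr of_int (m - 1)) = \<beta> * ((b powr of_int (m - 1)) powr s * G 1)"
      using step2.IH b unfolding eq by (simp add: G_scale powr_mult bs)
    then show ?case using \<beta> by simp
  qed (use b in simp)
  have G_close: "\<bar>G x / G 1 - x powr s\<bar> \<le> e / 2" if "0 \<le> x" "x \<le> M" for x
  proof (cases "x = 0")
    case True
    then show ?thesis using e by (simp add: G_def u_def v_def)
  next
    case False
    with that have "x > 0" by simp
    \<comment> \<open>The largest integer power of \<open>b\<close> not above \<open>x\<close>, so
      \<open>y \<le> x \<le> b * y\<close>. By monotonicity both \<open>G x / G 1\<close> and
      \<open>x powr s\<close> lie between \<open>y powr s\<close> and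
      \<open>\<beta> * y powr s\<close>, an interval of length at most \<open>e / 2\<close>.\<close>
    define y where "y = b powr of_int \<lfloor>log b x\<rfloor>"
    have "y > 0" using b by (simp add: y_def)
    have "y \<le> b powr log b x" unfolding y_def using b by (intro powr_mono) auto
    then have "y \<le> x" using b \<open>x > 0\<close> by simp
    have "b powr log b x \<le> b powr (of_int \<lfloor>log b x\<rfloor> + 1)" using b by (intro powr_mono) linarith+
    then have "x \<le> b * y" using b \<open>x > 0\<close> by (simp add: y_def powr_add mult.commute)
    have ys: "y powr s \<le> x powr s" using \<open>y \<le> x\<close> \<open>y > 0\<close> s by (intro powr_mono2) auto
    have xs: "x powr s \<le> \<beta> * y powr s"
      using powr_mono2[of s x "b * y"] \<open>x \<le> b * y\<close> \<open>x > 0\<close> \<open>y > 0\<close> b s by (simp add: powr_mult bs)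
    have Gy: "G y = y powr s * G 1" unfolding y_def by (rule G_powr)
    have "y powr s * G 1 \<le> G x" using G_mono[of y x] \<open>y \<le> x\<close> \<open>y > 0\<close> Gy by simp
    then have lower: "y powr s \<le> G x / G 1" using G1 by (simp add: field_simps)
    have "G x \<le> \<beta> * (y powr s * G 1)"
      using G_mono[of x "b * y"] G_scale[of y] \<open>x \<le> b * y\<close> \<open>x > 0\<close> \<open>y > 0\<close> Gy by simp
    then have upper: "G x / G 1 \<le> \<beta> * y powr s" using G1 by (simp add: field_simps)
    have "y powr s \<le> M powr s" using ys powr_mono2[of s x M] that s by simp
    then have "\<beta> * y powr s - y powr s \<le> e / 2" using \<beta>_err[of "y powr s"] by (simp add: algebra_simps)
    moreover have "\<bar>p - q\<bar> \<le> d - a" if "a \<le> p" "p \<le> d" "a \<le> q" "q \<le> d" for a d p q :: real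
      using that by (simp add: abs_le_iff)
    from this[OF lower upper ys xs]
    have "\<bar>G x / G 1 - x powr s\<bar> \<le> \<beta> * y powr s - y powr s" .
    ultimately show ?thesis by (rule order_trans[rotated])
  qed

  have "uniform_limit {0..M} (\<lambda>N x. \<Sum>n<N. u n x) (\<lambda>x. \<Sum>n. u n x) sequentially"
    by (rule Weierstrass_m_test[OF u_le[where K = M] sum_u]) simp_all
  moreover have "uniform_limit {0..M} (\<lambda>N x. \<Sum>n<N. v n x) (\<lambda>x. \<Sum>n. v n x) sequentially"
    by (rule Weierstrass_m_test[OF v_le sum_v]) simp
  ultimately have "uniform_limit {0..M} (\<lambda>N x. (\<Sum>n<N. u n x) + (\<Sum>n<N. v n x)) G sequentially"
    unfolding G_def by (rule uniform_limit_add)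
  \<comment> \<open>Truncation uses up the other \<open>e / 2\<close>; the factor \<open>G 1\<close>
    is cancelled by the normalisation in \<open>c\<close>.\<close>
  then have "\<forall>\<^sub>F N in sequentially. \<forall>x\<in>{0..M}.
      dist ((\<Sum>n<N. u n x) + (\<Sum>n<N. v n x)) (G x) < e / 2 * G 1"
    using e G1 by (intro uniform_limitD) simp_all
  then obtain N where N: "\<forall>x\<in>{0..M}. dist ((\<Sum>n<N. u n x) + (\<Sum>n<N. v n x)) (G x) < e / 2 * G 1"
    using eventually_happens'[OF sequentially_bot] by blast
  define c where "c = case_sum (\<lambda>n. \<beta> ^ n / G 1) (\<lambda>n. (1 / \<beta>) ^ Suc n / G 1)"
  define l where "l = case_sum (\<lambda>n. b ^ n) (\<lambda>n. (1 / b) ^ Suc n)"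
  show ?thesis
  proof (rule that[of "{..<N} <+> {..<N}" c l])
    show "0 \<le> c i" "0 < l i" for i
      using \<beta> b G1 by (cases i; simp add: c_def l_def)+
    fix x assume x: "0 \<le> x" "x \<le> M"
    have "(\<Sum>i\<in>{..<N} <+> {..<N}. c i * (x / (x + l i))) = ((\<Sum>n<N. u n x) + (\<Sum>n<N. v n x)) / G 1"
      by (simp add: sum.Plus c_def l_def u_def v_def add_divide_distrib sum_divide_distrib mult_ac)
    moreover have "\<bar>((\<Sum>n<N. u n x) + (\<Sum>n<N. v n x)) / G 1 - G x / G 1\<bar> \<le> e / 2"
      using bspec[OF N, of x] x G1
      by (simp add: dist_real_def pos_divide_le_eq less_imp_le flip: diff_divide_distrib)
    moreover have "\<bar>a - d\<bar> \<le> e" if "\<bar>a - q\<bar> \<le> e / 2" "\<bar>q - d\<bar> \<le> e / 2" for a q d :: real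
      using that by (simp add: abs_if split: if_splits)
    ultimately show "\<bar>(\<Sum>i\<in>{..<N} <+> {..<N}. c i * (x / (x + l i))) - x powr s\<bar> \<le> e"
      using G_close[OF x] by metis
  qed simp
qed


section \<open>Powers of positive operators\<close>

lemma continuous_on_powr_nonneg:
  "S \<subseteq> {0::real..} \<Longrightarrow> 0 < s \<Longrightarrow> continuous_on S (\<lambda>x. x powr s)"
  by (intro continuous_on_powr' continuous_intros) auto

lemma positive_op_adjoint: "positive_op A \<Longrightarrow> adjoint_pair A A"
  by (simp add: positive_op_def)

lemma approx_spectrum_interval:
  assumes "positive_op X" "norm X \<le> M"
  shows "approx_spectrum X \<subseteq> {0..M}"
  using approx_spectrum_positive[OF assms(1)] approx_spectrum_le_norm[of _ X] assms(2) by force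

abbreviation op_pow :: "('a::real_normed_vector \<Rightarrow>\<^sub>L 'a) \<Rightarrow> real \<Rightarrow> 'a \<Rightarrow>\<^sub>L 'a" where
  "op_pow X s \<equiv> op_fun (\<lambda>x. x powr s) X"

lemma continuous_on_op_pow:
  "positive_op X \<Longrightarrow> 0 < s \<Longrightarrow> continuous_on (approx_spectrum X) (\<lambda>x. x powr s)"
  using approx_spectrum_interval[of X "norm X"] by (intro continuous_on_powr_nonneg) auto

lemma positive_op_pow:
  fixes X :: "'a::{real_inner,banach} \<Rightarrow>\<^sub>L 'a"
  assumes "positive_op X" "0 < s"
  shows "positive_op (op_pow X s)"
  by (rule positive_op_fun[OF positive_op_adjoint[OF assms(1)] continuous_on_op_pow[OF assms]]) simp

lemma op_pow_one:
  fixes X :: "'a::{real_inner,banach} \<Rightarrow>\<^sub>L 'a"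
  assumes "positive_op X"
  shows "op_pow X 1 = X"
proof -
  have "op_pow X 1 = op_fun (\<lambda>x. x) X"
    using approx_spectrum_positive[OF assms] by (intro op_fun_cong) simp
  then show ?thesis using op_fun_ident[OF positive_op_adjoint[OF assms]] by simp
qed

lemma op_pow_add:
  fixes X :: "'a::{real_inner,banach} \<Rightarrow>\<^sub>L 'a"
  assumes "positive_op X" "0 < s" "0 < t"
  shows "op_pow X s o\<^sub>L op_pow X t = op_pow X (s + t)"
  using op_fun_mult[OF positive_op_adjoint[OF assms(1)] continuous_on_op_pow[OF assms(1,2)]
      continuous_on_op_pow[OF assms(1,3)]]
  by (simp add: powr_add)

lemma op_pow_pow:
  fixes X :: "'a::{real_inner,banach} \<Rightarrow>\<^sub>L 'a"
  assumes "positive_op X" "0 < s" "0 < t"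
  shows "op_pow (op_pow X s) t = op_pow X (s * t)"
proof -
  \<comment> \<open>Large enough that \<open>{0..M}\<close> contains both the image of the spectrum
    of \<open>X\<close> and the spectrum of \<open>op_pow X s\<close>.\<close>
  define M where "M = max (norm X powr s) (norm (op_pow X s))"
  have "op_pow (op_pow X s) t = op_fun (\<lambda>x. (x powr s) powr t) X"
  proof (rule op_fun_op_fun[OF positive_op_adjoint[OF assms(1)] continuous_on_op_pow[OF assms(1,2)]])
    show "compact {0..M}" "continuous_on {0..M} (\<lambda>x. x powr t)"
      using assms by (auto intro: continuous_on_powr_nonneg)
    show "(\<lambda>x. x powr s) ` approx_spectrum X \<subseteq> {0..M}"
    proof clarsimp
      fix x assume "x \<in> approx_spectrum X"
      then have "x powr s \<le> norm X powr s"
        using approx_spectrum_interval[OF assms(1) order_refl] assms(2) by (intro powr_mono2) auto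
      then show "x powr s \<le> M" by (simp add: M_def)
    qed
    show "approx_spectrum (op_pow X s) \<subseteq> {0..M}"
      using positive_op_pow[OF assms(1,2)] by (rule approx_spectrum_interval) (simp add: M_def)
  qed
  then show ?thesis by (simp add: powr_powr)
qed

text \<open>Expands \<open>0 \<le> \<langle>(X + l) (u - V w), u - V w\<rangle>\<close> with \<open>u = (X + l)\<^sup>-\<^sup>1 V x\<close> and
  \<open>w = (Z + l)\<^sup>-\<^sup>1 x\<close>.\<close>

lemma resolvent_conj_le:
  fixes X :: "'b::{real_inner,banach} \<Rightarrow>\<^sub>L 'b" and Z :: "'a::{real_inner,banach} \<Rightarrow>\<^sub>L 'a"
    and V :: "'a \<Rightarrow>\<^sub>L 'b"
  assumes V: "\<And>x y. inner (V x) (V y) = inner x y"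
    and X: "positive_op X" and Z: "positive_op Z"
    and le: "\<And>x. inner (X (V x)) (V x) \<le> inner (Z x) x" and l: "0 < l"
  shows "inner (op_fun (\<lambda>x. x / (x + l)) X (V x)) (V x) \<le> inner (op_fun (\<lambda>x. x / (x + l)) Z x) x"
proof -
  \<comment> \<open>Stated over a fresh type because \<open>X\<close> and \<open>Z\<close> act on
    different spaces.\<close>
  have resolvent: "A (op_fun (\<lambda>x. 1 / (x + l)) A v) + l *\<^sub>R op_fun (\<lambda>x. 1 / (x + l)) A v = v"
    "op_fun (\<lambda>x. x / (x + l)) A v = v - l *\<^sub>R op_fun (\<lambda>x. 1 / (x + l)) A v"
    if A: "positive_op A" for A :: "'c::{real_inner,banach} \<Rightarrow>\<^sub>L 'c" and v
  proof -
    note sa = positive_op_adjoint[OF A]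
    have pos: "x + l > 0" if "x \<in> approx_spectrum A" for x
      using approx_spectrum_positive[OF A that] l by simp
    then have cont: "continuous_on (approx_spectrum A) (\<lambda>x. 1 / (x + l))"
      by (intro continuous_intros) force
    have cont2: "continuous_on (approx_spectrum A) (\<lambda>x. x * (1 / (x + l)))"
      by (intro continuous_intros cont)
    have "op_fun (\<lambda>x. x / (x + l)) A = op_fun (\<lambda>x. x * (1 / (x + l))) A" by simp
    also have "\<dots> = A o\<^sub>L op_fun (\<lambda>x. 1 / (x + l)) A"
      using op_fun_mult[OF sa continuous_on_id cont] op_fun_ident[OF sa] by simp
    finally have 1: "op_fun (\<lambda>x. x / (x + l)) A = A o\<^sub>L op_fun (\<lambda>x. 1 / (x + l)) A" .
    have "op_fun (\<lambda>x. x * (1 / (x + l)) + l * (1 / (x + l))) A = op_fun (\<lambda>x. 1) A"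
      using pos by (intro op_fun_cong) (fastforce simp flip: add_divide_distrib)
    then have "op_fun (\<lambda>x. x / (x + l)) A + l *\<^sub>R op_fun (\<lambda>x. 1 / (x + l)) A = id_blinfun"
      using op_fun_add[OF sa cont2 continuous_on_mult_left[OF cont, of l]] op_fun_cmult[OF sa cont, of l]
        op_fun_const[OF sa, of 1] by simp
    from arg_cong[OF this, of "\<lambda>B. B v"] 1
    show "A (op_fun (\<lambda>x. 1 / (x + l)) A v) + l *\<^sub>R op_fun (\<lambda>x. 1 / (x + l)) A v = v"
      "op_fun (\<lambda>x. x / (x + l)) A v = v - l *\<^sub>R op_fun (\<lambda>x. 1 / (x + l)) A v"
      by (simp_all add: blinfun.bilinear_simps algebra_simps)
  qed
  define u where "u = op_fun (\<lambda>x. 1 / (x + l)) X (V x)"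
  define w where "w = op_fun (\<lambda>x. 1 / (x + l)) Z x"
  have u: "X u + l *\<^sub>R u = V x" and w: "Z w + l *\<^sub>R w = x"
    unfolding u_def w_def by (rule resolvent[OF X] resolvent[OF Z])+
  have "0 \<le> inner (X (u - V w)) (u - V w) + l * inner (u - V w) (u - V w)"
    using X l by (simp add: positive_op_def)
  also have "\<dots> = inner (X u + l *\<^sub>R u) u - 2 * inner (X u + l *\<^sub>R u) (V w)
      + (inner (X (V w)) (V w) + l * inner (V w) (V w))"
    using adjoint_pairD[OF positive_op_adjoint[OF X], of u "V w"]
    by (simp add: blinfun.bilinear_simps inner_simps inner_commute algebra_simps)
  also have "\<dots> \<le> inner (V x) u - 2 * inner x w + (inner (Z w) w + l * inner w w)"
    using le[of w] by (simp add: u V)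
  also have "inner (Z w) w + l * inner w w = inner x w"
    by (subst w[symmetric]) (simp add: inner_simps)
  finally have "inner w x \<le> inner u (V x)" by (simp add: inner_commute)
  \<comment> \<open>Since \<open>x / (x + l) = 1 - l / (x + l)\<close> and \<open>V\<close>
    preserves norms, the inequality between the resolvents reverses into the claim.\<close>
  then show ?thesis
    using l by (simp add: resolvent(2)[OF X] resolvent(2)[OF Z] inner_simps V flip: u_def w_def)
qed

text \<open>The Loewner-Heinz inequality is the case \<open>V = 1\<close>, Hansen's inequality for isometries
  the case \<open>Z = V\<^sup>* X V\<close>.\<close>

lemma op_pow_conj_le:
  fixes X :: "'b::{real_inner,banach} \<Rightarrow>\<^sub>L 'b" and Z :: "'a::{real_inner,banach} \<Rightarrow>\<^sub>L 'a"
    and V :: "'a \<Rightarrow>\<^sub>L 'b"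
  assumes V: "\<And>x y. inner (V x) (V y) = inner x y"
    and X: "positive_op X" and Z: "positive_op Z"
    and le: "\<And>x. inner (X (V x)) (V x) \<le> inner (Z x) x" and s: "0 < s" "s \<le> 1"
  shows "inner (op_pow X s (V x)) (V x) \<le> inner (op_pow Z s x) x"
proof (cases "s = 1")
  \<comment> \<open>The resolvent approximation is limited to \<open>s < 1\<close>; at
    \<open>s = 1\<close> the claim is the assumption itself.\<close>
  case True
  show ?thesis unfolding True op_pow_one[OF X] op_pow_one[OF Z] by (rule le)
next
  case False
  with s have s1: "s < 1" by simp
  define M where "M = max (norm X) (norm Z)"
  have normV: "norm (V x) = norm x" by (simp add: norm_eq_sqrt_inner V)
  have *: "inner (op_pow X s (V x)) (V x) \<le> inner (op_pow Z s x) x + 2 * e * (norm x)\<^sup>2"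
    if "e > 0" for e
  proof -
    have "0 \<le> M" by (simp add: M_def le_max_iff_disj)
    then obtain I :: "(nat + nat) set" and c l where I: "finite I" "\<And>i. 0 \<le> c i" "\<And>i. 0 < l i"
      "\<And>x. 0 \<le> x \<Longrightarrow> x \<le> M \<Longrightarrow> \<bar>(\<Sum>i\<in>I. c i * (x / (x + l i))) - x powr s\<bar> \<le> e"
      using powr_resolvent_approx[OF s(1) s1 _ \<open>e > 0\<close>] by metis
    define g where "g x = (\<Sum>i\<in>I. c i * (x / (x + l i)))" for x
    have g: "op_fun g A = (\<Sum>i\<in>I. c i *\<^sub>R op_fun (\<lambda>x. x / (x + l i)) A)"
      "\<bar>inner (op_fun g A v) v - inner (op_pow A s v) v\<bar> \<le> e * (norm v)\<^sup>2"
      if A: "positive_op A" "norm A \<le> M" for A :: "'c::{real_inner,banach} \<Rightarrow>\<^sub>L 'c" and v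
    proof -
      note sa = positive_op_adjoint[OF A(1)]
      note spec = approx_spectrum_interval[OF A]
      have cont: "continuous_on (approx_spectrum A) (\<lambda>x. x / (x + l i))" for i
        using spec I(3)[of i] by (intro continuous_intros) force
      have cont_g: "continuous_on (approx_spectrum A) g"
        unfolding g_def by (intro continuous_on_sum continuous_on_mult_left cont)
      show "op_fun g A = (\<Sum>i\<in>I. c i *\<^sub>R op_fun (\<lambda>x. x / (x + l i)) A)"
        unfolding g_def op_fun_cmult[OF sa cont, symmetric]
        by (rule op_fun_sum[OF sa]) (intro continuous_on_mult_left cont)
      have cont_s: "continuous_on (approx_spectrum A) (\<lambda>x. x powr s)"
        by (rule continuous_on_op_pow[OF A(1) s(1)])
      define D where "D = op_fun g A - op_pow A s"
      have "norm D \<le> e"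
        unfolding D_def op_fun_diff[OF sa cont_g cont_s, symmetric]
        using spec I(4) \<open>e > 0\<close>
        by (intro norm_op_fun_le[OF sa] continuous_on_diff cont_g cont_s) (auto simp: g_def)
      have "\<bar>inner (D v) v\<bar> \<le> norm (D v) * norm v" by (rule Cauchy_Schwarz_ineq2)
      also have "\<dots> \<le> (norm D * norm v) * norm v" by (intro mult_right_mono norm_blinfun) auto
      also have "\<dots> \<le> (e * norm v) * norm v" using \<open>norm D \<le> e\<close> by (intro mult_right_mono) auto
      finally show "\<bar>inner (op_fun g A v) v - inner (op_pow A s v) v\<bar> \<le> e * (norm v)\<^sup>2"
        by (simp add: D_def blinfun.bilinear_simps inner_simps power2_eq_square)
    qed
    have MX: "norm X \<le> M" and MZ: "norm Z \<le> M" by (auto simp: M_def)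
    \<comment> \<open>Nonnegative coefficients let the inequality for each
      \<open>x / (x + l i)\<close> pass to their sum.\<close>
    have "inner (op_fun g X (V x)) (V x) \<le> inner (op_fun g Z x) x"
      unfolding g(1)[OF X MX] g(1)[OF Z MZ]
      using resolvent_conj_le[OF V X Z le I(3)] I(2)
      by (auto simp: blinfun.bilinear_simps blinfun.sum_left inner_sum_left intro!: sum_mono mult_left_mono)
    then show ?thesis
      using g(2)[OF X MX, of "V x"] g(2)[OF Z MZ, of x] by (simp add: normV abs_le_iff)
  qed
  show ?thesis
  proof (rule field_le_epsilon)
    fix d :: real assume "d > 0"
    define e where "e = d / (2 * ((norm x)\<^sup>2 + 1))"
    have "(norm x)\<^sup>2 + 1 > 0" by (simp add: add_nonneg_pos)
    then have "e > 0" "2 * e * (norm x)\<^sup>2 \<le> d" using \<open>d > 0\<close> by (auto simp: e_def field_simps)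
    with *[of e] show "inner (op_pow X s (V x)) (V x) \<le> inner (op_pow Z s x) x + d" by simp
  qed
qed

section \<open>Conjugation by an isometry\<close>

lemma positive_op_conj:
  assumes "adjoint_pair U U'" "positive_op X"
  shows "positive_op (U o\<^sub>L X o\<^sub>L U')"
proof -
  have "adjoint_pair (U o\<^sub>L X o\<^sub>L U') (U o\<^sub>L X o\<^sub>L U')"
    using assms by (simp add: adjoint_pair_def positive_op_def) (metis inner_commute)
  moreover have "0 \<le> inner (U (X (U' x))) x" for x
    using adjoint_pairD[OF assms(1), of "X (U' x)" x] assms(2) by (simp add: positive_op_def)
  ultimately show ?thesis by (simp add: positive_op_def)
qed

text \<open>A polynomial of \<open>U X U'\<close> is \<open>U p(X) U'\<close> plus
  \<open>p(0)\<close> times the projection \<open>1 - U U'\<close>. That extra term disappears in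
  the limit because the approximants tend to \<open>0 powr s = 0\<close> at \<open>0\<close>; hence
  the approximation takes place on an interval containing \<open>0\<close> as well as both
  spectra.\<close>

lemma op_pow_isometry_conj:
  fixes X :: "'a::{real_inner,banach} \<Rightarrow>\<^sub>L 'a" and U :: "'a \<Rightarrow>\<^sub>L 'b::{real_inner,banach}"
  assumes U: "adjoint_pair U U'" "U' o\<^sub>L U = id_blinfun" and X: "positive_op X" and s: "0 < s"
  shows "op_pow (U o\<^sub>L X o\<^sub>L U') s = U o\<^sub>L op_pow X s o\<^sub>L U'"
proof -
  define Y where "Y = U o\<^sub>L X o\<^sub>L U'"
  have Y: "positive_op Y" unfolding Y_def by (rule positive_op_conj[OF U(1) X])
  have Y_apply: "Y v = U (X (U' v))" for v by (simp add: Y_def)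
  have [simp]: "U' (U v) = v" for v
    using arg_cong[OF U(2), of "\<lambda>B. B v"] by simp
  have poly: "poly_op p Y = (U o\<^sub>L poly_op p X o\<^sub>L U') + poly p 0 *\<^sub>R (id_blinfun - (U o\<^sub>L U'))" for p
  proof (induction p)
    case (pCons a p)
    show ?case
      by (rule blinfun_eqI)
        (simp add: pCons blinfun.bilinear_simps Y_apply algebra_simps)
  qed simp
  define M where "M = max (norm X) (norm Y)"
  have M: "0 \<le> M" by (simp add: M_def le_max_iff_disj)
  obtain P where P: "uniform_limit {0..M} (\<lambda>n::nat. poly (P n)) (\<lambda>x. x powr s) sequentially"
    using uniform_limit_poly_exists[OF compact_Icc continuous_on_powr_nonneg[OF _ s, of "{0..M}"]] by auto
  have sub: "approx_spectrum X \<subseteq> {0..M}" "approx_spectrum Y \<subseteq> {0..M}"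
    using approx_spectrum_interval[OF X] approx_spectrum_interval[OF Y] by (auto simp: M_def)
  have "(\<lambda>n. poly_op (P n) X) \<longlonglongrightarrow> op_pow X s"
    by (rule op_fun_tendsto[OF positive_op_adjoint[OF X] continuous_on_op_pow[OF X s]
          uniform_limit_on_subset[OF P sub(1)]])
  moreover have "(\<lambda>n. poly (P n) 0) \<longlonglongrightarrow> 0"
    using tendsto_uniform_limitI[OF P, of 0] M by simp
  ultimately have "(\<lambda>n. poly_op (P n) Y) \<longlonglongrightarrow> (U o\<^sub>L op_pow X s o\<^sub>L U') + 0 *\<^sub>R (id_blinfun - (U o\<^sub>L U'))"
    unfolding poly by (intro tendsto_intros)
  from op_fun_eqI[OF positive_op_adjoint[OF Y] continuous_on_op_pow[OF Y s]
      uniform_limit_on_subset[OF P sub(2)] this]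
  show ?thesis by (simp add: Y_def)
qed

lemma blinfun_compose_assoc: "(A o\<^sub>L B) o\<^sub>L C = A o\<^sub>L (B o\<^sub>L C)"
  by (rule blinfun_eqI) simp

lemma op_pow_isometry_sandwich_le:
  fixes P :: "'a::{real_inner,banach} \<Rightarrow>\<^sub>L 'a"
  assumes P: "positive_op P" and U: "adjoint_pair U U'" "U' o\<^sub>L U = id_blinfun"
    and p: "0 < p" and s: "0 < s" "s \<le> 1" and r: "0 < r" "r * s \<le> p"
    and le: "\<And>x. inner (op_pow (U o\<^sub>L P o\<^sub>L U') p x) x \<le> inner (op_pow P p x) x"
  defines "Q \<equiv> op_pow P (r / 2)"
  shows "inner (op_pow ((U o\<^sub>L Q o\<^sub>L U) o\<^sub>L (U' o\<^sub>L Q o\<^sub>L U')) s x) x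
    \<le> inner (op_pow ((U' o\<^sub>L Q o\<^sub>L U') o\<^sub>L (U o\<^sub>L Q o\<^sub>L U)) s x) x"
proof -
  have U'U [simp]: "U' (U v) = v" for v
    using arg_cong[OF U(2), of "\<lambda>B. B v"] by simp
  have iso: "inner (U v) (U w) = inner v w" for v w
    by (simp add: adjoint_pairD[OF U(1)])
  have "norm (U v) = norm v" for v by (simp add: norm_eq_sqrt_inner iso)
  \<comment> \<open>The adjoint of an isometry is a contraction. This is the estimate
    \<open>U U' \<le> 1\<close> behind the first inequality of the chain.\<close>
  have U'_le: "norm (U' v) \<le> norm v" for v
  proof -
    have "norm (U' v) * norm (U' v) = inner (U (U' v)) v"
      by (simp add: adjoint_pairD[OF U(1)] flip: power2_norm_eq_inner power2_eq_square)
    also have "\<dots> \<le> norm (U' v) * norm v"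
      using norm_cauchy_schwarz[of "U (U' v)" v] \<open>norm (U (U' v)) = norm (U' v)\<close> by simp
    finally show ?thesis by (cases "norm (U' v) = 0") auto
  qed
  have Q: "positive_op Q" unfolding Q_def using r by (intro positive_op_pow P) simp
  note Q_adj = positive_op_adjoint[OF Q]
  have QQ: "Q (Q v) = op_pow P r v" for v
    using arg_cong[OF op_pow_add[OF P, of "r / 2" "r / 2"], of "\<lambda>B. B v"] r by (simp add: Q_def)
  define S where "S = U o\<^sub>L Q o\<^sub>L U"
  define S' where "S' = U' o\<^sub>L Q o\<^sub>L U'"
  have S: "adjoint_pair S S'"
    unfolding S_def S'_def using adjoint_pair_compose[OF adjoint_pair_compose[OF U(1) Q_adj] U(1)]
    by (simp add: blinfun_compose_assoc)
  have pos_S: "positive_op (S o\<^sub>L S')" "positive_op (S' o\<^sub>L S)"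
    using positive_op_compose_adjoint[OF S] positive_op_compose_adjoint[OF adjoint_pair_sym[OF S]] by auto
  have Pr: "positive_op (op_pow P r)" and rs: "0 < r * s" using P r s by (auto intro: positive_op_pow)
  have id: "inner (id_blinfun v) (id_blinfun w) = inner v w" for v w :: 'a by simp

  have "inner ((S o\<^sub>L S') v) v \<le> inner ((U o\<^sub>L op_pow P r o\<^sub>L U') v) v" for v
  proof -
    have "inner ((S o\<^sub>L S') v) v = (norm (U' (Q (U' v))))\<^sup>2"
      using adjoint_pairD[OF S, of "S' v" v] by (simp add: S'_def power2_norm_eq_inner)
    also have "\<dots> \<le> (norm (Q (U' v)))\<^sup>2" by (intro power_mono U'_le) simp
    also have "\<dots> = inner (Q (Q (U' v))) (U' v)"
      by (simp add: power2_norm_eq_inner adjoint_pairD[OF Q_adj])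
    also have "\<dots> = inner ((U o\<^sub>L op_pow P r o\<^sub>L U') v) v"
      by (simp add: QQ adjoint_pairD[OF U(1)])
    finally show ?thesis .
  qed
  then have "inner (op_pow (S o\<^sub>L S') s x) x \<le> inner (op_pow (U o\<^sub>L op_pow P r o\<^sub>L U') s x) x"
    using op_pow_conj_le[OF id pos_S(1) positive_op_conj[OF U(1) Pr] _ s] by simp
  also have "op_pow (U o\<^sub>L op_pow P r o\<^sub>L U') s = U o\<^sub>L op_pow P (r * s) o\<^sub>L U'"
    using op_pow_isometry_conj[OF U Pr s(1)] op_pow_pow[OF P r(1) s(1)] by simp
  finally have 1: "inner (op_pow (S o\<^sub>L S') s x) x \<le> inner ((U o\<^sub>L op_pow P (r * s) o\<^sub>L U') x) x" .

  \<comment> \<open>Raising the hypothesis from power \<open>p\<close> to power \<open>r * s\<close>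
    takes this exponent, and \<open>r * s \<le> p\<close> keeps it in the Loewner-Heinz
    range.\<close>
  define t where "t = r * s / p"
  have t: "0 < t" "t \<le> 1" "p * t = r * s" using p rs r by (auto simp: t_def)
  have 2: "inner ((U o\<^sub>L op_pow P (r * s) o\<^sub>L U') v) v \<le> inner (op_pow P (r * s) v) v" for v
  proof -
    have "inner (op_pow (op_pow (U o\<^sub>L P o\<^sub>L U') p) t v) v \<le> inner (op_pow (op_pow P p) t v) v"
      using op_pow_conj_le[OF id positive_op_pow[OF positive_op_conj[OF U(1) P] p]
          positive_op_pow[OF P p] _ t(1,2)] le by simp
    then show ?thesis
      using op_pow_pow[OF positive_op_conj[OF U(1) P] p t(1)] op_pow_pow[OF P p t(1)]
        op_pow_isometry_conj[OF U P rs] by (simp add: t(3))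
  qed
  \<comment> \<open>Evaluating inequality \<open>2\<close> at \<open>U x\<close> is the conjugation
    by \<open>U\<close>: on the left, \<open>U' (U x) = x\<close>.\<close>
  have "inner (op_pow P (r * s) x) x = inner ((U o\<^sub>L op_pow P (r * s) o\<^sub>L U') (U x)) (U x)"
    by (simp add: iso)
  also have "\<dots> \<le> inner (op_pow P (r * s) (U x)) (U x)" by (rule 2)
  also have "\<dots> = inner (op_pow (op_pow P r) s (U x)) (U x)"
    by (simp add: op_pow_pow[OF P r(1) s(1)])
  also have "\<dots> \<le> inner (op_pow (S' o\<^sub>L S) s x) x"
  \<comment> \<open>Hansen's inequality with \<open>V = U\<close>. Its premise holds with equality:
    the inner factors of \<open>S' o\<^sub>L S\<close> cancel by \<open>U' U = 1\<close>, leaving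
    \<open>U' Q Q U\<close>.\<close>
  proof (rule op_pow_conj_le[OF iso Pr pos_S(2) _ s])
    fix v
    show "inner (op_pow P r (U v)) (U v) \<le> inner ((S' o\<^sub>L S) v) v"
      using adjoint_pairD[OF U(1), of v "op_pow P r (U v)"]
      by (simp add: S_def S'_def QQ inner_commute)
  qed
  finally show ?thesis
    using 1 2[of x] unfolding S_def S'_def by simp
qed

section \<open>Quaternionic Hilbert spaces as real Hilbert spaces\<close>

lemma qcnj_qcnj [simp]: "qcnj (qcnj q) = q"
  by (simp add: qcnj_def)

lemma qRe_qcnj [simp]: "qRe (qcnj q) = qRe q"
  by (simp add: qcnj_def)

lemma qcnj_mult: "qcnj (p * q) = qcnj q * qcnj p"
  by (simp add: quat_eq_iff qcnj_def times_quat_def algebra_simps)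

lemma qRe_mult_commute: "qRe (p * q) = qRe (q * p)"
  by (simp add: times_quat_def algebra_simps)

text \<open>Multiplying by the four basis units brings each component, up to sign, into the real
  part. This recovers quaternionic identities from real ones.\<close>

lemma quat_eqI_qRe_mult:
  assumes "\<And>q. qRe (a * q) = qRe (b * q)"
  shows "a = b"
  using assms[of "Quat 1 0 0 0"] assms[of "Quat 0 1 0 0"] assms[of "Quat 0 0 1 0"]
    assms[of "Quat 0 0 0 1"]
  by (simp add: quat_eq_iff times_quat_def)

lemma of_real_mult_commute: "of_real r * (q::quat) = q * of_real r"
  by (simp add: of_real_def)

lemma scaleQ_zero_right: "(u::'h::right_quat_hilbert) *\<^sub>Q 0 = 0"
  using scaleQ_of_real[of u 0] by simp

lemma scaleR_scaleQ: "(r *\<^sub>R u) *\<^sub>Q q = r *\<^sub>R (u *\<^sub>Q q)" for u :: "'h::right_quat_hilbert"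
  by (metis of_real_mult_commute scaleQ_of_real scaleQ_scaleQ)

lemma qinner_scaleQ_right: "qinner u (v *\<^sub>Q q) = qinner u v * q" for u :: "'h::right_quat_hilbert"
  using qinner_right[of u v q v 0] by (simp add: scaleQ_zero_right)

lemma qinner_zero_left: "qinner 0 (v::'h::right_quat_hilbert) = 0"
  using qinner_scaleQ_right[of v v 0] qinner_commute[of v 0]
  by (simp add: scaleQ_zero_right) (simp add: qcnj_def zero_quat_def)

text \<open>The real part of a product of two quaternions is symmetric in the factors, so right
  multiplication by \<open>q\<close> has right multiplication by \<open>qcnj q\<close> as its real
  adjoint.\<close>

lemma inner_scaleQ_left: "inner (u *\<^sub>Q q) v = inner u (v *\<^sub>Q qcnj q)" for u :: "'h::right_quat_hilbert"
proof -
  have "inner (u *\<^sub>Q q) v = qRe (qinner v u * q)"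
    by (metis inner_commute inner_eq_qRe_qinner qinner_scaleQ_right)
  also have "\<dots> = qRe (qcnj (q * qinner v u))" by (simp add: qRe_mult_commute)
  also have "\<dots> = inner u (v *\<^sub>Q qcnj q)"
    by (simp add: qcnj_mult qinner_commute inner_eq_qRe_qinner qinner_scaleQ_right)
  finally show ?thesis .
qed

section \<open>Right linear operators, quaternionic adjoints and positivity\<close>

lemma qboundedD: "T \<in> \<BB> \<Longrightarrow> blinfun_apply T (x *\<^sub>Q q) = blinfun_apply T x *\<^sub>Q q"
  by (simp add: qbounded_ops_def)

lemma qbounded_id: "id_blinfun \<in> \<BB>"
  by (simp add: qbounded_ops_def)

lemma qbounded_compose: "S \<in> \<BB> \<Longrightarrow> T \<in> \<BB> \<Longrightarrow> S o\<^sub>L T \<in> \<BB>"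
  by (simp add: qbounded_ops_def)

lemma qbounded_add: "S \<in> \<BB> \<Longrightarrow> T \<in> \<BB> \<Longrightarrow> S + T \<in> \<BB>"
  by (simp add: qbounded_ops_def blinfun.bilinear_simps scaleQ_add_left)

lemma qbounded_scaleR: "T \<in> \<BB> \<Longrightarrow> c *\<^sub>R T \<in> \<BB>"
  by (simp add: qbounded_ops_def blinfun.bilinear_simps scaleR_scaleQ)

lemma qbounded_diff: "S \<in> \<BB> \<Longrightarrow> T \<in> \<BB> \<Longrightarrow> S - T \<in> \<BB>"
  using qbounded_add[of S "-1 *\<^sub>R T"] qbounded_scaleR[of T "-1"] by simp

lemma qbounded_zero: "0 \<in> \<BB>"
  using qbounded_scaleR[OF qbounded_id, of 0] by simp

lemma inner_eqI: "(\<And>y. inner a y = inner b y) \<Longrightarrow> a = b"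
  for a b :: "'a::real_inner"
  using inner_eq_zero_iff[of "a - b"] by (simp add: inner_diff_left)

text \<open>Tested against \<open>y\<close>, the scalar moves to the other side as
  \<open>qcnj q\<close>, and right linearity becomes an identity between limits of inner
  products.\<close>

lemma closed_qbounded:
  fixes F :: "nat \<Rightarrow> 'h::right_quat_hilbert \<Rightarrow>\<^sub>L 'h"
  assumes "F \<longlonglongrightarrow> A" "\<And>n. F n \<in> \<BB>"
  shows "A \<in> \<BB>"
  unfolding qbounded_ops_def
proof (intro CollectI allI, rule inner_eqI)
  fix x q y
  have "(\<lambda>n. inner (F n (x *\<^sub>Q q)) y) \<longlonglongrightarrow> inner (A (x *\<^sub>Q q)) y"
    "(\<lambda>n. inner (F n x) (y *\<^sub>Q qcnj q)) \<longlonglongrightarrow> inner (A x) (y *\<^sub>Q qcnj q)"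
    using assms(1) by (auto intro!: tendsto_intros)
  moreover have "inner (F n (x *\<^sub>Q q)) y = inner (F n x) (y *\<^sub>Q qcnj q)" for n
    by (simp add: qboundedD[OF assms(2)] inner_scaleQ_left)
  ultimately show "inner (A (x *\<^sub>Q q)) y = inner (A x *\<^sub>Q q) y"
    using LIMSEQ_unique by (simp add: inner_scaleQ_left)
qed

lemma qbounded_poly_op: "T \<in> \<BB> \<Longrightarrow> poly_op p T \<in> \<BB>"
  by (induction p) (auto intro: qbounded_zero qbounded_add qbounded_scaleR qbounded_id qbounded_compose)

lemma qbounded_op_fun:
  "T \<in> \<BB> \<Longrightarrow> adjoint_pair T T \<Longrightarrow> continuous_on (approx_spectrum T) f \<Longrightarrow> op_fun f T \<in> \<BB>"
  by (metis op_fun_approx closed_qbounded qbounded_poly_op)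

lemma qbounded_inverse:
  assumes "A \<in> \<BB>" "S o\<^sub>L A = id_blinfun" "A o\<^sub>L S = id_blinfun"
  shows "S \<in> \<BB>"
proof -
  have *: "S (A x) = x" "A (S x) = x" for x
    using arg_cong[OF assms(2), of "\<lambda>B. B x"] arg_cong[OF assms(3), of "\<lambda>B. B x"] by simp_all
  have "S (x *\<^sub>Q q) = S x *\<^sub>Q q" for x q
    using *(1)[of "S x *\<^sub>Q q"] by (simp add: qboundedD[OF assms(1)] *(2))
  then show ?thesis by (simp add: qbounded_ops_def)
qed

text \<open>Scalars can be moved across the real inner product, so the adjoint from the real Riesz
  theorem is automatically right linear.\<close>

lemma qbounded_adjoint:
  assumes "T \<in> \<BB>" "adjoint_pair T S"
  shows "S \<in> \<BB>"
  unfolding qbounded_ops_def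
proof (intro CollectI allI, rule inner_eqI)
  fix x q y
  have "inner y (S (x *\<^sub>Q q)) = inner (T y) (x *\<^sub>Q q)"
    by (rule adjoint_pairD[OF assms(2), symmetric])
  also have "\<dots> = inner (T (y *\<^sub>Q qcnj q)) x"
    by (simp add: qboundedD[OF assms(1)] inner_scaleQ_left)
  also have "\<dots> = inner y (S x *\<^sub>Q q)"
    by (simp add: adjoint_pairD[OF assms(2)] inner_scaleQ_left)
  finally show "inner (S (x *\<^sub>Q q)) y = inner (S x *\<^sub>Q q) y" by (simp add: inner_commute)
qed

text \<open>The real identity at \<open>v *\<^sub>Q q\<close> for every \<open>q\<close> determines
  the whole quaternion, not only its real part.\<close>

lemma qinner_adjoint_iff:
  assumes "T \<in> \<BB>" "S \<in> \<BB>"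
  shows "(\<forall>u v. qinner (blinfun_apply T u) v = qinner u (blinfun_apply S v)) \<longleftrightarrow> adjoint_pair T S"
proof
  assume S: "adjoint_pair T S"
  show "\<forall>u v. qinner (T u) v = qinner u (S v)"
  proof (intro allI quat_eqI_qRe_mult)
    fix u v q
    show "qRe (qinner (T u) v * q) = qRe (qinner u (S v) * q)"
      using adjoint_pairD[OF S, of u "v *\<^sub>Q q"]
      by (simp add: inner_eq_qRe_qinner qinner_scaleQ_right qboundedD[OF assms(2)])
  qed
qed (simp add: adjoint_pair_def inner_eq_qRe_qinner)

lemma qadjoint_eqI:
  assumes "T \<in> \<BB>" "adjoint_pair T S"
  shows "qadjoint T = S"
  unfolding qadjoint_def
proof (rule the_equality)
  show "S \<in> \<BB> \<and> (\<forall>u v. qinner (T u) v = qinner u (S v))"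
    using qbounded_adjoint[OF assms] qinner_adjoint_iff[OF assms(1)] assms(2) by blast
  show "S' = S" if "S' \<in> \<BB> \<and> (\<forall>u v. qinner (T u) v = qinner u (S' v))" for S'
    using that qinner_adjoint_iff[OF assms(1)] adjoint_pair_unique[OF _ assms(2)] by blast
qed

lemma qadjoint:
  assumes "T \<in> \<BB>"
  shows "adjoint_pair T (qadjoint T)" "qadjoint T \<in> \<BB>"
proof -
  obtain S where "adjoint_pair T S" by (rule adjoint_exists)
  then show "adjoint_pair T (qadjoint T)" using qadjoint_eqI[OF assms] by simp
  then show "qadjoint T \<in> \<BB>" by (rule qbounded_adjoint[OF assms])
qed

text \<open>Selfadjointness makes \<open>qinner (A x) x\<close> equal to its own conjugate, hence
  real, so its real part carries all the information.\<close>

lemma qpositive_iff: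
  assumes "A \<in> \<BB>" "adjoint_pair A A"
  shows "qpositive A \<longleftrightarrow> (\<forall>x. 0 \<le> inner (blinfun_apply A x) x)"
proof -
  have "qinner (A x) x = of_real (inner (A x) x)" for x
  proof -
    have "qcnj (qinner (A x) x) = qinner (A x) x"
      using qinner_adjoint_iff[OF assms(1,1)] assms(2) qinner_commute by metis
    then show ?thesis
      by (simp add: inner_eq_qRe_qinner quat_eq_iff qcnj_def of_real_def scaleR_quat_def one_quat_def)
  qed
  then show ?thesis
    using assms(1) by (simp add: qpositive_def)
qed

text \<open>At a real point \<open>S_delta\<close> is the square of \<open>B = T - x\<close>. If
  \<open>B\<close> is bounded below, \<open>B o\<^sub>L B\<close> is coercive and thus invertible;
  conversely a left inverse \<open>S\<close> of the square gives the left inverse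
  \<open>S o\<^sub>L B\<close> of \<open>B\<close>.\<close>

lemma real_S_spectrum_eq:
  fixes T :: "'h::right_quat_hilbert \<Rightarrow>\<^sub>L 'h"
  assumes "T \<in> \<BB>" "adjoint_pair T T"
  shows "real_S_spectrum T = approx_spectrum T"
proof -
  have "(\<exists>S\<in>\<BB>. S o\<^sub>L S_delta (of_real x) T = id_blinfun \<and> S_delta (of_real x) T o\<^sub>L S = id_blinfun)
      \<longleftrightarrow> bounded_below (T - x *\<^sub>R id_blinfun)" (is "?inv \<longleftrightarrow> _") for x
  proof -
    define B where "B = T - x *\<^sub>R id_blinfun"
    have "S_delta (of_real x) T = B o\<^sub>L B"
    proof -
      have "qRe (of_real x + qcnj (of_real x)) = x * 2"
        by (simp add: of_real_def scaleR_quat_def one_quat_def qcnj_def plus_quat_def)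
      moreover have "(x * 2) *\<^sub>R v = x *\<^sub>R v + x *\<^sub>R v" for v :: 'h
        by (metis mult_2_right scaleR_add_left)
      ultimately show ?thesis
        by (auto intro!: blinfun_eqI
            simp: S_delta_def B_def blinfun.bilinear_simps algebra_simps power2_eq_square)
    qed
    moreover have "B \<in> \<BB>"
      unfolding B_def by (intro qbounded_diff qbounded_scaleR qbounded_id assms)
    have B: "adjoint_pair B B"
      using adjoint_pair_add[OF assms(2) adjoint_pair_scaleR[OF adjoint_pair_id, of "- x"]]
      by (simp add: B_def)
    have "?inv" if "bounded_below B"
    proof -
      obtain c where c: "c > 0" "\<And>v. c * norm v \<le> norm (B v)"
        using \<open>bounded_below B\<close> by (auto simp: bounded_below_def)
      have "c\<^sup>2 * (norm v)\<^sup>2 \<le> inner ((B o\<^sub>L B) v) v" for v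
      proof -
        have "(c * norm v)\<^sup>2 \<le> (norm (B v))\<^sup>2" using c by (intro power_mono) auto
        then show ?thesis
          by (simp add: power_mult_distrib power2_norm_eq_inner adjoint_pairD[OF B])
      qed
      then obtain S where S: "S o\<^sub>L (B o\<^sub>L B) = id_blinfun" "(B o\<^sub>L B) o\<^sub>L S = id_blinfun"
        using coercive_inverse[of "c\<^sup>2" "B o\<^sub>L B"] c(1) by auto
      moreover have "S \<in> \<BB>"
        using qbounded_inverse[OF qbounded_compose[OF \<open>B \<in> \<BB>\<close> \<open>B \<in> \<BB>\<close>] S] .
      ultimately show ?thesis unfolding \<open>S_delta (of_real x) T = B o\<^sub>L B\<close> by blast
    qed
    moreover have "bounded_below B" if ?inv
    proof -
      obtain S where S: "S o\<^sub>L (B o\<^sub>L B) = id_blinfun"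
        using \<open>?inv\<close> unfolding \<open>S_delta (of_real x) T = B o\<^sub>L B\<close> by blast
      define K where "K = norm (S o\<^sub>L B) + 1"
      have "K > 0" by (simp add: K_def add_nonneg_pos)
      have "norm v \<le> K * norm (B v)" for v
      proof -
        have "norm v = norm ((S o\<^sub>L B) (B v))"
          using arg_cong[OF S, of "\<lambda>B. B v"] by simp
        also have "\<dots> \<le> norm (S o\<^sub>L B) * norm (B v)" by (rule norm_blinfun)
        also have "\<dots> \<le> K * norm (B v)" by (intro mult_right_mono) (auto simp: K_def)
        finally show ?thesis .
      qed
      then show ?thesis
        using \<open>K > 0\<close> unfolding bounded_below_def
        by (intro exI[of _ "1 / K"]) (auto simp: field_simps)
    qed
    ultimately show ?thesis unfolding B_def by blast
  qed
  then show ?thesis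
    by (auto simp: real_S_spectrum_def S_spectrum_def approx_spectrum_def)
qed

lemma continuous_calculus_op_fun:
  fixes T :: "'h::right_quat_hilbert \<Rightarrow>\<^sub>L 'h"
  assumes "T \<in> \<BB>" "adjoint_pair T T"
  shows "continuous_calculus T (\<lambda>f. op_fun f T)"
  unfolding continuous_calculus_def Let_def real_S_spectrum_eq[OF assms]
  using assms op_fun_const[OF assms(2), of 1] op_fun_ident[OF assms(2)]
  by (auto simp: op_fun_add op_fun_cmult op_fun_mult intro: qbounded_op_fun op_fun_cong op_fun_uniform_limit)

text \<open>The algebraic conditions fix the calculus on polynomials, and continuity extends this to
  uniform limits.\<close>

lemma continuous_calculus_unique:
  fixes T :: "'h::right_quat_hilbert \<Rightarrow>\<^sub>L 'h"
  assumes T: "T \<in> \<BB>" "adjoint_pair T T" and \<phi>: "continuous_calculus T \<phi>"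
    and f: "continuous_on (approx_spectrum T) f"
  shows "\<phi> f = op_fun f T"
proof -
  note \<phi> = \<phi>[unfolded continuous_calculus_def Let_def real_S_spectrum_eq[OF T], simplified]
  have \<phi>_add: "\<phi> (\<lambda>x. g x + h x) = \<phi> g + \<phi> h" and \<phi>_mult: "\<phi> (\<lambda>x. g x * h x) = \<phi> g o\<^sub>L \<phi> h"
    and \<phi>_cmult: "\<phi> (\<lambda>x. c * g x) = c *\<^sub>R \<phi> g"
    if "continuous_on (approx_spectrum T) g" "continuous_on (approx_spectrum T) h" for g h c
    using \<phi> that by blast+
  have \<phi>_lim: "\<forall>F f. (\<forall>n::nat. continuous_on (approx_spectrum T) (F n)) \<and>
      continuous_on (approx_spectrum T) f \<and> uniform_limit (approx_spectrum T) F f sequentially \<longrightarrow>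
      (\<lambda>n. \<phi> (F n)) \<longlonglongrightarrow> \<phi> f"
    using \<phi> by (elim conjE) assumption
  have \<phi>_1: "\<phi> (\<lambda>x. 1) = id_blinfun" and \<phi>_id: "\<phi> (\<lambda>x. x) = T" using \<phi> by blast+
  have poly: "\<phi> (poly p) = poly_op p T" for p
  proof (induction p)
    case 0
    \<comment> \<open>Writing zero as \<open>0 * 1\<close> lets the scalar rule yield the zero
      operator.\<close>
    have "poly 0 = (\<lambda>x::real. 0 * 1)" by auto
    then show ?case
      using \<phi>_cmult[OF continuous_on_const continuous_on_const, of 0 1] by simp
  next
    case (pCons a p)
    have "poly (pCons a p) = (\<lambda>x. a * 1 + x * poly p x)" by auto
    then have "\<phi> (poly (pCons a p)) = \<phi> (\<lambda>x. a * 1 + x * poly p x)" by simp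
    also have "\<phi> (\<lambda>x. a * 1 + x * poly p x) = \<phi> (\<lambda>x. a * 1) + \<phi> (\<lambda>x. x * poly p x)"
      by (intro \<phi>_add continuous_intros)
    also have "\<phi> (\<lambda>x. a * 1) = a *\<^sub>R id_blinfun"
      using \<phi>_cmult[OF continuous_on_const continuous_on_const, of a 1] \<phi>_1 by simp
    also have "\<phi> (\<lambda>x. x * poly p x) = T o\<^sub>L poly_op p T"
      using \<phi>_mult[of "\<lambda>x. x" "poly p"] \<phi>_id pCons.IH by (simp add: continuous_on_poly continuous_on_id)
    finally show ?case by simp
  qed
  obtain P where P: "uniform_limit (approx_spectrum T) (\<lambda>n. poly (P n)) f sequentially"
    "(\<lambda>n. poly_op (P n) T) \<longlonglongrightarrow> op_fun f T" using op_fun_approx[OF T(2) f] .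
  have "continuous_on (approx_spectrum T) (poly (P n))" for n
    by (intro continuous_intros)
  then have "(\<lambda>n. \<phi> (poly (P n))) \<longlonglongrightarrow> \<phi> f"
    using \<phi>_lim[rule_format, of "\<lambda>n. poly (P n)" f] P(1) f by simp
  with P(2) show ?thesis unfolding poly using LIMSEQ_unique by blast
qed

text \<open>Existence and uniqueness of the calculus together resolve the definite description in
  \<open>fun_calculus\<close>.\<close>

lemma op_powr_eq:
  fixes T :: "'h::right_quat_hilbert \<Rightarrow>\<^sub>L 'h"
  assumes "T \<in> \<BB>" "positive_op T" "0 < s"
  shows "T powr\<^sub>Q s = op_pow T s"
  unfolding op_powr_def fun_calculus_def
proof (rule the_equality)
  note sa = positive_op_adjoint[OF assms(2)]
  show "\<exists>\<phi>. continuous_calculus T \<phi> \<and> op_pow T s = \<phi> (\<lambda>x. x powr s)"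
    using continuous_calculus_op_fun[OF assms(1) sa] by blast
  show "A = op_pow T s" if "\<exists>\<phi>. continuous_calculus T \<phi> \<and> A = \<phi> (\<lambda>x. x powr s)" for A
    using that continuous_calculus_unique[OF assms(1) sa _ continuous_on_op_pow[OF assms(2,3)]] by blast
qed

lemma qbounded_op_pow:
  fixes T :: "'h::right_quat_hilbert \<Rightarrow>\<^sub>L 'h"
  assumes "T \<in> \<BB>" "positive_op T" "0 < s"
  shows "op_pow T s \<in> \<BB>"
  using assms by (intro qbounded_op_fun continuous_on_op_pow positive_op_adjoint)

section \<open>Hyponormality as a comparison of real quadratic forms\<close>

lemma qop_le_iff:
  fixes A B :: "'h::right_quat_hilbert \<Rightarrow>\<^sub>L 'h"
  assumes "A \<in> \<BB>" "B \<in> \<BB>" "adjoint_pair A A" "adjoint_pair B B"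
  shows "A \<le>\<^sub>Q B \<longleftrightarrow> (\<forall>x. inner (blinfun_apply A x) x \<le> inner (blinfun_apply B x) x)"
proof -
  have "adjoint_pair (B - A) (B - A)"
    using adjoint_pair_add[OF assms(4) adjoint_pair_scaleR[OF assms(3), of "-1"]] by simp
  from qpositive_iff[OF qbounded_diff[OF assms(2,1)] this] show ?thesis
    by (simp add: qop_le_def blinfun.bilinear_simps inner_simps)
qed

lemma positive_op_qadjoint:
  assumes "T \<in> \<BB>"
  shows "positive_op (qadjoint T o\<^sub>L T)" "positive_op (T o\<^sub>L qadjoint T)"
    "qadjoint T o\<^sub>L T \<in> \<BB>" "T o\<^sub>L qadjoint T \<in> \<BB>"
  using positive_op_compose_adjoint[OF qadjoint(1)[OF assms]]
    positive_op_compose_adjoint[OF adjoint_pair_sym[OF qadjoint(1)[OF assms]]]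
    qbounded_compose qadjoint(2)[OF assms] assms by blast+

lemma s_hyponormal_iff:
  fixes T :: "'h::right_quat_hilbert \<Rightarrow>\<^sub>L 'h"
  assumes "T \<in> \<BB>" "0 < s"
  shows "s_hyponormal s T \<longleftrightarrow> (\<forall>x. inner (op_pow (T o\<^sub>L qadjoint T) s x) x
    \<le> inner (op_pow (qadjoint T o\<^sub>L T) s x) x)"
  using assms positive_op_qadjoint[OF assms(1)]
  by (simp add: s_hyponormal_def op_powr_eq qop_le_iff qbounded_op_pow positive_op_pow positive_op_adjoint)

lemma hyponormal_iff_s_hyponormal:
  fixes T :: "'h::right_quat_hilbert \<Rightarrow>\<^sub>L 'h"
  assumes "T \<in> \<BB>"
  shows "hyponormal T \<longleftrightarrow> s_hyponormal 1 T"
proof -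
  have "X powr\<^sub>Q 1 = X" if "X \<in> \<BB>" "positive_op X" for X :: "'h \<Rightarrow>\<^sub>L 'h"
    using op_powr_eq[OF that zero_less_one] op_pow_one[OF that(2)] by (rule trans)
  with positive_op_qadjoint[OF assms] show ?thesis
    by (simp add: hyponormal_def s_hyponormal_def)
qed

text \<open>A free exponent \<open>s\<close> treats both cases at once. The work is to translate the
  polar decomposition into an isometry \<open>U\<close> with adjoint \<open>U'\<close> and the
  positive operator \<open>P\<close>.\<close>

lemma s_hyponormal_S_transform:
  fixes T U :: "'h::right_quat_hilbert \<Rightarrow>\<^sub>L 'h"
  assumes T: "T \<in> \<BB>" "inj (blinfun_apply T)" and hyp: "s_hyponormal p T" and p: "0 < p"
    and polar: "polar_decomposition T U" and s: "0 < s" "s \<le> 1" and r: "0 < r" "r * s \<le> p"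
  shows "S_transform r T U \<in> \<BB>" "s_hyponormal s (S_transform r T U)"
proof -
  define P where "P = qadjoint T o\<^sub>L T"
  have P: "positive_op P" "P \<in> \<BB>" using positive_op_qadjoint[OF T(1)] by (auto simp: P_def)
  define A where "A = op_pow P (1/2)"
  have abs: "op_abs T = A" by (simp add: op_abs_def A_def P_def[symmetric] op_powr_eq P)
  have A: "positive_op A" "A \<in> \<BB>"
    unfolding A_def using P by (auto intro: positive_op_pow qbounded_op_pow)
  have AA: "A o\<^sub>L A = P"
    using op_pow_add[OF P(1), of "1/2" "1/2"] op_pow_one[OF P(1)] by (simp add: A_def)
  have TUA: "T = U o\<^sub>L A" and "U \<in> \<BB>" and isom: "\<And>x. x \<in> initial_space U \<Longrightarrow> norm (U x) = norm x"
    and init: "initial_space U = qorth (op_ker A)"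
    using polar by (auto simp: polar_decomposition_def partial_isometry_def initial_space_def abs)
  \<comment> \<open>Injectivity of \<open>T\<close> passes to its modulus, so the initial space of
    \<open>U\<close> is everything; polarisation then makes \<open>U\<close> preserve inner
    products.\<close>
  have "x = 0" if "A x = 0" for x
    using injD[OF T(2), of x 0] that by (simp add: TUA)
  then have "op_ker A = {0}" by (auto simp: op_ker_def blinfun.zero_right)
  then have "initial_space U = UNIV" by (simp add: init qorth_def qinner_zero_left)
  with isom have normU: "norm (U x) = norm x" for x by simp
  have iso: "inner (U x) (U y) = inner x y" for x y
    using normU[of "x + y"] normU[of x] normU[of y]
    by (simp add: dot_norm flip: blinfun.add_right)
  define U' where "U' = qadjoint U"
  have U: "adjoint_pair U U'" "U' \<in> \<BB>" using qadjoint[OF \<open>U \<in> \<BB>\<close>] by (auto simp: U'_def)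
  have U'U: "U' o\<^sub>L U = id_blinfun"
    by (rule blinfun_eqI, rule inner_eqI) (simp add: adjoint_pairD[OF adjoint_pair_sym[OF U(1)]] iso)
  have "qadjoint T = A o\<^sub>L U'"
    using adjoint_pair_compose[OF U(1) positive_op_adjoint[OF A(1)]]
    by (intro qadjoint_eqI T) (simp add: TUA)
  then have "T o\<^sub>L qadjoint T = U o\<^sub>L (A o\<^sub>L A) o\<^sub>L U'"
    by (auto intro!: blinfun_eqI simp: TUA)
  then have TT: "T o\<^sub>L qadjoint T = U o\<^sub>L P o\<^sub>L U'" by (simp add: AA)
  define Q where "Q = op_pow P (r / 2)"
  have Q: "positive_op Q" "Q \<in> \<BB>"
    unfolding Q_def using P r by (auto intro: positive_op_pow qbounded_op_pow)
  \<comment> \<open>The modulus is \<open>P\<close> to the power \<open>1/2\<close>, hence the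
    exponent \<open>r / 2\<close> in \<open>Q\<close>.\<close>
  have "A powr\<^sub>Q r = Q"
    using op_pow_pow[OF P(1), of "1/2" r] r by (simp add: op_powr_eq A Q_def A_def[symmetric])
  then have S: "S_transform r T U = U o\<^sub>L Q o\<^sub>L U" by (simp add: S_transform_def abs)
  show SB: "S_transform r T U \<in> \<BB>"
    unfolding S by (intro qbounded_compose \<open>U \<in> \<BB>\<close> Q)
  have "qadjoint (S_transform r T U) = U' o\<^sub>L Q o\<^sub>L U'"
    using adjoint_pair_compose[OF adjoint_pair_compose[OF U(1) positive_op_adjoint[OF Q(1)]] U(1)] SB
    unfolding S by (intro qadjoint_eqI) (simp_all add: blinfun_compose_assoc)
  then show "s_hyponormal s (S_transform r T U)"
    unfolding s_hyponormal_iff[OF SB s(1)]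
    using op_pow_isometry_sandwich_le[OF P(1) U(1) U'U p s r] hyp[unfolded s_hyponormal_iff[OF T(1) p]]
    by (simp add: S TT Q_def flip: P_def)
qed

theorem theorem12:
  fixes T U :: "'h::right_quat_hilbert \<Rightarrow>\<^sub>L 'h" and p :: real
  assumes "0 < p" and "p \<le> 1"
    and "T \<in> \<BB>"
    and "inj (blinfun_apply T)"
    and "s_hyponormal p T"
    and "polar_decomposition T U"
  shows "\<forall>r::real. 0 < r \<and> r \<le> 1/2 \<longrightarrow>
           (0 < p \<and> p \<le> 1/2 \<longrightarrow> s_hyponormal (2 * p) (S_transform r T U)) \<and>
           (1/2 < p \<and> p \<le> 1 \<longrightarrow> hyponormal (S_transform r T U))"
proof (intro allI impI conjI; elim conjE)
  fix r :: real assume r: "0 < r" "r \<le> 1/2"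
  note hyp = s_hyponormal_S_transform[OF assms(3,4,5,1,6) _ _ r(1)]
  show "s_hyponormal (2 * p) (S_transform r T U)" if "p \<le> 1/2"
    \<comment> \<open>Here \<open>r * (2 * p) \<le> p\<close> is exactly \<open>r \<le> 1/2\<close>
      multiplied by \<open>2 * p\<close>.\<close>
    using assms(1) that r mult_right_mono[of r "1/2" "2 * p"] by (intro hyp) auto
  show "hyponormal (S_transform r T U)" if "1/2 < p"
    \<comment> \<open>With \<open>s = 1\<close> the condition is \<open>r \<le> p\<close>, which
      follows from \<open>r \<le> 1/2 < p\<close>.\<close>
    using hyp[of 1] r that by (simp add: hyponormal_iff_s_hyponormal)
qed

end
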